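(* For any $\mathbf{a}, \mathbf{b} \in \mathcal{Q}$, $\mathbf{a} \equiv \mathbf{b}$ implies that $\xi \mathbf{a} \equiv \xi \mathbf{b}$, and if $\mathbf{a}, \mathbf{b} \in \mathcal{R}$, $\mathbf{a} \equiv \mathbf{b}$ implies $\nabla \mathbf{a} \equiv \nabla \mathbf{b}$.
   Context: Colored words are finite words over the alphabet $\overline{\mathbb{Z}}=\{i^{[j]} : i\in\mathbb{Z}, j\in\mathbb{Z}_+\}$ (value $i$, color $j$), totally ordered by value then color; $\mathbb{Z}$ is identified with color-$1$ letters. For a colored word $\boldsymbol{p}$, $\operatorname{maxcol}(\boldsymbol{p})$ is its largest color and $\boldsymbol{p}\uparrow a$ adds $a$ to every color. The colored shuffle product is $\boldsymbol{p}\boldsymbol{q} := \boldsymbol{p} \sqcup\!\sqcup (\boldsymbol{q}\uparrow \operatorname{maxcol}(\boldsymbol{p}))$, where $\sqcup\!\sqcup$ is the (Eilenberg–Mac Lane) shuffle product: the formal sum of all interlacings of the two words preserving the order of each. $\mathcal{Q}=\mathbb{Q}[\overline{\mathbb{Z}}^*]$ is the algebra of colored words under this product. For $\boldsymbol{t}=(t_1,\dots,t_k)$, its maximal bottom row $m(\boldsymbol{t})\in\mathbb{Z}^k$ is defined by $m(\boldsymbol{t})_k=\mathrm{val}(t_k)$ and, for $j<k$, $m(\boldsymbol{t})_j=m(\boldsymbol{t})_{j+1}$ if $t_j\ge t_{j+1}$, and $m(\boldsymbol{t})_j=\min(\mathrm{val}(t_j), m(\boldsymbol{t})_{j+1}-1)$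 if $t_j<t_{j+1}$. Colored words satisfy $\boldsymbol{p}\equiv\boldsymbol{q}$ iff $m(\boldsymbol{p})=m(\boldsymbol{q})$, extended linearly (equivalently, $\mathbf{a}\equiv\mathbf{b}$ iff they have the same image under $\phi:\mathbf{a}\mapsto\overleftarrow{\mathfrak{F}}_{\mathbf{a}}$, the back-stable slide polynomial map). For $w\in S_\mathbb{Z}$, $\mathbf{Sch}(w)=\sum_{\boldsymbol{w}\in\mathcal{RW}(w)}\boldsymbol{w}$ (sum of reduced words), and $\mathcal{R}$ is the subalgebra of $\mathcal{Q}$ generated by all $\mathbf{Sch}(w)$. The linear operators $\nabla,\xi$ on $\mathcal{Q}$ are $\nabla(p_1,\dots,p_k)=\mathrm{val}(p_1)(p_2,\dots,p_k)$ and $\xi(p_1,\dots,p_k)=(p_2,\dots,p_k)$. *)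

theory Defs
  imports
    Complex_Main
    "HOL-Library.Poly_Mapping"
    "HOL-Combinatorics.Permutations"
begin

subsection \<open>Colored letters and words\<close>

typedef letter = "{(i, j) :: int \<times> nat | i j. j > 0}"
  by auto

definition letter :: "int \<Rightarrow> nat \<Rightarrow> letter" where
  "letter i j = Abs_letter (i, j)"

definition val :: "letter \<Rightarrow> int" where
  "val x = fst (Rep_letter x)"

definition col :: "letter \<Rightarrow> nat" where
  "col x = snd (Rep_letter x)"

lemma col_pos: "col x > 0"
  using Rep_letter[of x] by (auto simp: col_def)

lemma val_letter [simp]: "j > 0 \<Longrightarrow> val (letter i j) = i"
  and col_letter [simp]: "j > 0 \<Longrightarrow> col (letter i j) = j"
  by (simp_all add: val_def col_def letter_def Abs_letter_inverse)

lemma letter_eqI: "val x = val y \<Longrightarrow> col x = col y \<Longrightarrow> x = y"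
  by (simp add: val_def col_def Rep_letter_inject [symmetric] prod_eq_iff)

instantiation letter :: linorder
begin

definition less_eq_letter :: "letter \<Rightarrow> letter \<Rightarrow> bool" where
  "x \<le> y \<longleftrightarrow> val x < val y \<or> val x = val y \<and> col x \<le> col y"

definition less_letter :: "letter \<Rightarrow> letter \<Rightarrow> bool" where
  "x < y \<longleftrightarrow> val x < val y \<or> val x = val y \<and> col x < col y"

instance
  by standard (auto simp: less_eq_letter_def less_letter_def intro: letter_eqI)

end

type_synonym cword = "letter list"

text \<open>The empty word has maximal color \<open>0\<close>, which makes it the unit of the colored shuffle product.\<close>

definition maxcol :: "cword \<Rightarrow> nat" where
  "maxcol p = Max (insert 0 (col ` set p))"

definition raise_col :: "cword \<Rightarrow> nat \<Rightarrow> cword" (infixl \<open>\<up>\<close> 70) where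
  "p \<up> a = map (\<lambda>x. letter (val x) (col x + a)) p"

fun max_bottom_row :: "cword \<Rightarrow> int list" where
  "max_bottom_row [] = []"
| "max_bottom_row [t] = [val t]"
| "max_bottom_row (t # u # ts) =
     (let m = max_bottom_row (u # ts)
      in (if t \<ge> u then hd m else min (val t) (hd m - 1)) # m)"


subsection \<open>The free vector space on a set of words\<close>

type_synonym Q = "cword \<Rightarrow>\<^sub>0 rat"

definition scale :: "rat \<Rightarrow> ('a \<Rightarrow>\<^sub>0 rat) \<Rightarrow> ('a \<Rightarrow>\<^sub>0 rat)" where
  "scale c a = Poly_Mapping.map (\<lambda>x. c * x) a"

abbreviation basis :: "'a \<Rightarrow> ('a \<Rightarrow>\<^sub>0 rat)" where
  "basis p \<equiv> Poly_Mapping.single p 1"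

definition lin_ext :: "('a \<Rightarrow> ('b \<Rightarrow>\<^sub>0 rat)) \<Rightarrow> ('a \<Rightarrow>\<^sub>0 rat) \<Rightarrow> ('b \<Rightarrow>\<^sub>0 rat)" where
  "lin_ext f a = (\<Sum>p \<in> Poly_Mapping.keys a. scale (Poly_Mapping.lookup a p) (f p))"

lemma lookup_scale [simp]: "Poly_Mapping.lookup (scale c a) p = c * Poly_Mapping.lookup a p"
  by (simp add: scale_def Poly_Mapping.map.rep_eq when_def)

global_interpretation Q: vector_space scale
  by standard (auto intro!: poly_mapping_eqI simp: lookup_add algebra_simps)

lemma lin_ext_superset:
  assumes "finite A" "Poly_Mapping.keys a \<subseteq> A"
  shows "lin_ext f a = (\<Sum>p\<in>A. scale (Poly_Mapping.lookup a p) (f p))"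
  unfolding lin_ext_def
  using assms by (intro sum.mono_neutral_left) (auto simp: in_keys_iff)

lemma lin_ext_add: "lin_ext f (a + b) = lin_ext f a + lin_ext f b"
proof -
  let ?A = "Poly_Mapping.keys a \<union> Poly_Mapping.keys b"
  have "Poly_Mapping.keys (a + b) \<subseteq> ?A"
    by (rule Poly_Mapping.keys_add)
  then show ?thesis
    by (simp add: lin_ext_superset[of ?A] lookup_add Q.scale_left_distrib sum.distrib)
qed

lemma lin_ext_scale: "lin_ext f (scale c a) = scale c (lin_ext f a)"
proof -
  have "Poly_Mapping.keys (scale c a) \<subseteq> Poly_Mapping.keys a"
    by (auto simp: in_keys_iff)
  then show ?thesis
    by (simp add: lin_ext_superset[of "Poly_Mapping.keys a"] Q.scale_sum_right)
qed

lemma lin_ext_basis [simp]: "lin_ext f (basis p) = f p"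
  by (simp add: lin_ext_def)

lemma lin_ext_diff: "lin_ext f (a - b) = lin_ext f a - lin_ext f b"
  by (metis add_diff_cancel diff_add_cancel lin_ext_add)

lemma lin_ext_id: "lin_ext basis a = a"
proof (rule poly_mapping_eqI)
  fix k
  have "Poly_Mapping.lookup (lin_ext basis a) k =
      (\<Sum>p\<in>Poly_Mapping.keys a. if p = k then Poly_Mapping.lookup a p else 0)"
    unfolding lin_ext_def lookup_sum
    by (rule sum.cong) (simp_all add: lookup_single when_def)
  also have "\<dots> = Poly_Mapping.lookup a k"
    by (simp add: sum.delta' in_keys_iff)
  finally show "Poly_Mapping.lookup (lin_ext basis a) k = Poly_Mapping.lookup a k" .
qed


subsection \<open>The colored shuffle product\<close>

text \<open>Unlike the library's \<open>shuffles\<close>, this is a list, so interlacings that coincide as words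
  are counted with multiplicity.\<close>

fun interlacings :: "'a list \<Rightarrow> 'a list \<Rightarrow> 'a list list" where
  "interlacings [] q = [q]"
| "interlacings p [] = [p]"
| "interlacings (x # p) (y # q) =
     map ((#) x) (interlacings p (y # q)) @ map ((#) y) (interlacings (x # p) q)"

definition shuffle :: "'a list \<Rightarrow> 'a list \<Rightarrow> ('a list \<Rightarrow>\<^sub>0 rat)" where
  "shuffle p q = sum_list (map basis (interlacings p q))"

definition cshuffle :: "cword \<Rightarrow> cword \<Rightarrow> Q" where
  "cshuffle p q = shuffle p (q \<up> maxcol p)"

definition Qmult :: "Q \<Rightarrow> Q \<Rightarrow> Q" (infixl \<open>\<star>\<close> 70) where
  "a \<star> b = lin_ext (\<lambda>p. lin_ext (\<lambda>q. cshuffle p q) b) a"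


subsection \<open>The equivalence\<close>

text \<open>The linear extension of the relation \<open>m(p) = m(q)\<close> on words, that is, the smallest linear
  congruence that contains it.\<close>

definition Qequiv :: "Q \<Rightarrow> Q \<Rightarrow> bool" (infix \<open>\<doteq>\<close> 50) where
  "a \<doteq> b \<longleftrightarrow>
     a - b \<in> Q.span {basis p - basis q | p q. max_bottom_row p = max_bottom_row q}"

lemma Qequiv_iff:
  "a \<doteq> b \<longleftrightarrow>
     lin_ext (\<lambda>p. basis (max_bottom_row p)) a = lin_ext (\<lambda>p. basis (max_bottom_row p)) b"
  (is "_ \<longleftrightarrow> ?M a = ?M b")
proof
  let ?G = "{basis p - basis q | p q. max_bottom_row p = max_bottom_row q}"
  assume "a \<doteq> b"
  then have "a - b \<in> Q.span ?G"
    by (simp add: Qequiv_def)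
  then have "?M (a - b) = 0"
  proof (induction rule: Q.span_induct_alt)
    case base
    show ?case by (simp add: lin_ext_def)
  next
    case (step c x y)
    then show ?case
      by (auto simp: lin_ext_add lin_ext_scale lin_ext_diff)
  qed
  then show "?M a = ?M b"
    by (simp add: lin_ext_diff)
next
  let ?G = "{basis p - basis q | p q. max_bottom_row p = max_bottom_row q}"
  assume eq: "?M a = ?M b"
  define r :: "int list \<Rightarrow> cword" where "r m = (SOME p. max_bottom_row p = m)" for m
  have r: "max_bottom_row (r (max_bottom_row p)) = max_bottom_row p" for p
    unfolding r_def by (rule someI) (rule refl)
  let ?N = "lin_ext (\<lambda>m. basis (r m))"
  have N: "?N (?M x) = lin_ext (\<lambda>p. basis (r (max_bottom_row p))) x" for x
  proof -
    have sum: "?N (\<Sum>i\<in>A. h i) = (\<Sum>i\<in>A. ?N (h i))" if "finite A" for A and h :: "cword \<Rightarrow> _"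
      using that by (induction A rule: finite_induct) (simp_all add: lin_ext_add, simp add: lin_ext_def)
    show ?thesis
      by (subst (2 3) lin_ext_def) (simp add: sum lin_ext_scale)
  qed
  have span: "x - ?N (?M x) \<in> Q.span ?G" for x
  proof -
    have "x - ?N (?M x) =
        (\<Sum>p\<in>Poly_Mapping.keys x. scale (Poly_Mapping.lookup x p)
           (basis p - basis (r (max_bottom_row p))))"
      unfolding N Q.scale_right_diff_distrib sum_subtractf
      by (subst lin_ext_id[symmetric, of x]) (simp only: lin_ext_def)
    also have "\<dots> \<in> Q.span ?G"
      using r by (intro Q.span_sum Q.span_scale Q.span_base) force
    finally show ?thesis .
  qed
  from Q.span_diff[OF span[of a] span[of b]] show "a \<doteq> b"
    by (simp add: Qequiv_def eq)
qed

lemma Qequiv_basis: "basis p \<doteq> basis q \<longleftrightarrow> max_bottom_row p = max_bottom_row q"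
proof -
  have "basis x = basis y \<longleftrightarrow> x = y" for x y :: "int list"
  proof
    assume "basis x = basis y"
    then have "Poly_Mapping.keys (basis x) = Poly_Mapping.keys (basis y)"
      by (rule arg_cong)
    then show "x = y"
      by simp
  qed simp
  then show ?thesis
    by (simp only: Qequiv_iff lin_ext_basis)
qed


subsection \<open>Reduced words and the subalgebra they generate\<close>

definition S_Z :: "(int \<Rightarrow> int) set" where
  "S_Z = {w. bij w \<and> finite {i. w i \<noteq> i}}"

definition word_perm :: "int list \<Rightarrow> (int \<Rightarrow> int)" where
  "word_perm ws = foldr (\<lambda>i u. transpose i (i + 1) \<circ> u) ws id"

definition reduced_words :: "(int \<Rightarrow> int) \<Rightarrow> int list set" where
  "reduced_words w =
     {ws. word_perm ws = w \<and> (\<forall>vs. word_perm vs = w \<longrightarrow> length ws \<le> length vs)}"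

text \<open>The set of reduced words is finite, since all reduced words of a permutation use the
  same letters; integers are read as letters of color 1.\<close>

definition Sch :: "(int \<Rightarrow> int) \<Rightarrow> Q" where
  "Sch w = (\<Sum>ws \<in> reduced_words w. basis (map (\<lambda>i. letter i 1) ws))"

inductive_set R :: "Q set" where
  one: "basis [] \<in> R"
| Sch: "w \<in> S_Z \<Longrightarrow> Sch w \<in> R"
| add: "a \<in> R \<Longrightarrow> b \<in> R \<Longrightarrow> a + b \<in> R"
| scale: "a \<in> R \<Longrightarrow> scale c a \<in> R"
| mult: "a \<in> R \<Longrightarrow> b \<in> R \<Longrightarrow> a \<star> b \<in> R"


subsection \<open>The operators\<close>

text \<open>Both operators kill the empty word: they act as derivations, so they vanish on the unit.\<close>

definition nabla :: "Q \<Rightarrow> Q" (\<open>\<nabla>\<close>) where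
  "\<nabla> = lin_ext (\<lambda>p. case p of [] \<Rightarrow> 0 | x # p' \<Rightarrow> scale (of_int (val x)) (basis p'))"

definition xi :: "Q \<Rightarrow> Q" (\<open>\<xi>\<close>) where
  "\<xi> = lin_ext (\<lambda>p. case p of [] \<Rightarrow> 0 | x # p' \<Rightarrow> basis p')"

end

theory Submission
  imports Defs "HOL-Library.Function_Algebras" "HOL-Library.Multiset"
begin

text \<open>
  The tail of \<open>m(t)\<close> is the maximal bottom row of the tail of \<open>t\<close>, so \<open>\<xi>\<close> respects the equivalence
  on all of \<open>Q\<close>. For \<open>\<nabla>\<close>, send a word to its slide polynomial in the finitely many variables
  \<open>x\<^sub>i, \<dots>, x\<^bsub>i+n-1\<^esub>\<close>. This map is multiplicative, depends only on \<open>m(t)\<close>, and has leading monomial \<open>m(t)\<close>,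
  so it detects the equivalence once the range is large enough. Both \<open>\<nabla> + (1 - i) \<xi>\<close> and the sum
  \<open>D\<close> of all partial derivatives are derivations over it, hence they agree on the subalgebra \<open>R\<close> as soon
  as they agree on every \<open>Sch w\<close>.

  The latter holds in the nilCoxeter algebra with generators \<open>u\<^sub>k\<close>. Following Fomin and Stanley, the
  Schubert polynomials are the coefficients of the product of
  \<open>A\<^sub>i(x\<^sub>i) = (1 + x\<^sub>i u\<^sub>t) \<cdots> (1 + x\<^sub>i u\<^sub>i)\<close> over increasing \<open>i\<close>, where \<open>t\<close> is the last index. With
  \<open>E\<^sub>i = \<Sum>\<^bsub>k\<ge>i\<^esub> (k - i + 1) u\<^sub>k\<close> one has \<open>D A\<^sub>i = E\<^sub>i A\<^sub>i - A\<^sub>i E\<^bsub>i+1\<^esub>\<close>, because \<open>\<Sum>\<^bsub>k\<ge>i\<^esub> u\<^sub>k\<close> commutes with \<open>A\<^sub>i\<close>;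
  so the derivative of the product telescopes to \<open>E\<^sub>i\<close> times the product.
\<close>

section \<open>A telescoping identity in the nilCoxeter algebra\<close>

text \<open>The class is that of unital rings without \<open>0 \<noteq> 1\<close>, because a ring of
  endomorphisms may be trivial.\<close>

locale nil_coxeter =
  fixes u :: "int \<Rightarrow> 'r::{ring,monoid_mult}"
  assumes nil: "u k * u k = 0"
    and commute: "j + 2 \<le> k \<Longrightarrow> u j * u k = u k * u j"
    and braid: "u k * u (k + 1) * u k = u (k + 1) * u k * u (k + 1)"
begin

text \<open>Here \<open>x\<close> is a ring element and not a scalar, so that a derivation can later
  be an element of the same ring that does not commute with \<open>x\<close>.\<close>

fun A :: "'r \<Rightarrow> int \<Rightarrow> nat \<Rightarrow> 'r" where
  "A x i 0 = 1"
| "A x i (Suc n) = A x (i + 1) n * (1 + x * u i)"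

fun T :: "int \<Rightarrow> nat \<Rightarrow> 'r" where
  "T i 0 = 0"
| "T i (Suc n) = u i + T (i + 1) n"

text \<open>Adding up the tails \<open>T\<close> gives \<open>u k\<close> the coefficient
  \<open>k - i + 1\<close> without any integer multiples.\<close>

fun E :: "int \<Rightarrow> nat \<Rightarrow> 'r" where
  "E i 0 = 0"
| "E i (Suc n) = T i (Suc n) + E (i + 1) n"

text \<open>All factors share the top index \<open>i + n - 1\<close>. This is the Fomin-Stanley
  product, truncated to finitely many variables and generators.\<close>

fun S :: "(int \<Rightarrow> 'r) \<Rightarrow> int \<Rightarrow> nat \<Rightarrow> 'r" where
  "S x i 0 = 1"
| "S x i (Suc n) = A (x i) i (Suc n) * S x (i + 1) n"

text \<open>The leftmost factor, of highest index, is the one that meets the first letter of a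
  reduced word.\<close>

lemma A_Suc_top: "A x i (Suc n) = (1 + x * u (i + int n)) * A x i n"
proof (induction n arbitrary: i)
  case (Suc n)
  have "A x i (Suc (Suc n)) = A x (i + 1) (Suc n) * (1 + x * u i)"
    by simp
  also have "\<dots> = (1 + x * u (i + 1 + int n)) * A x (i + 1) n * (1 + x * u i)"
    by (simp only: Suc.IH)
  finally show ?case
    by (simp add: mult.assoc add.assoc)
qed simp

lemma u_T_commute: "j + 2 \<le> i \<Longrightarrow> u j * T i n = T i n * u j"
  by (induction n arbitrary: i) (simp_all add: distrib_left distrib_right commute)

lemma u_E_commute: "j + 2 \<le> i \<Longrightarrow> u j * E i n = E i n * u j"
  by (induction n arbitrary: i)
    (simp_all add: distrib_left distrib_right commute u_T_commute del: T.simps)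

lemma u_A_commute:
  assumes "\<And>k. u k * x = x * u k" "j + 2 \<le> i"
  shows "u j * A x i n = A x i n * u j"
  using assms(2)
proof (induction n arbitrary: i)
  case (Suc n)
  have "u j * (1 + x * u i) = (1 + x * u i) * u j"
    using assms(1)[of j] commute[OF Suc.prems]
    by (simp add: distrib_left distrib_right mult.assoc) (metis mult.assoc)
  moreover have "u j * A x (i + 1) n = A x (i + 1) n * u j"
    using Suc by simp
  ultimately show ?case
    by (simp add: mult.assoc) (metis mult.assoc)
qed simp

text \<open>\<open>T i n\<close> is the linear coefficient of \<open>A x i n\<close>, so this is the
  infinitesimal form of the Fomin-Stanley commutation of \<open>A x i n\<close> with
  \<open>A y i n\<close>. In the induction the new generator \<open>u i\<close> fails to commute
  only with \<open>u (i + 1)\<close>.\<close>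

lemma T_A_commute:
  assumes x: "\<And>k. u k * x = x * u k"
  shows "T i n * A x i n = A x i n * T i n"
proof (induction n arbitrary: i)
  case (Suc n)
  show ?case
  proof (cases n)
    case 0
    then show ?thesis
      by (simp add: distrib_left distrib_right mult.assoc x) (simp add: mult.assoc[symmetric] x)
  next
    case (Suc m)
    define a v w B where "a = T (i + 2) m" and "v = u i" and "w = u (i + 1)"
      and "B = A x (i + 2) m"
    have xs: "v * x = x * v" "w * x = x * w" "v * (x * y) = x * (v * y)"
       "w * (x * y) = x * (w * y)" for y
      by (simp_all add: v_def w_def x mult.assoc[symmetric])
    have nilvw: "v * v = 0" "v * (v * y) = 0" "w * w = 0" "w * (w * y) = 0" for y
      by (simp_all add: v_def w_def nil mult.assoc[symmetric])
    have br: "v * (w * v) = w * (v * w)"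
      using braid[of i] by (simp add: v_def w_def mult.assoc)
    have vB: "v * B = B * v"
      unfolding v_def B_def by (rule u_A_commute) (simp_all add: x)
    have va: "v * a = a * v"
      unfolding v_def a_def by (rule u_T_commute) simp
    have IH: "(w + a) * (B * (1 + x * w)) = B * (1 + x * w) * (w + a)"
      using Suc.IH[of "i + 1"] by (simp add: Suc add.assoc w_def a_def B_def)
    \<comment> \<open>Only the two lowest generators remain. The terms quadratic in \<open>x\<close>
      agree by the braid relation, all others once the squares of \<open>v\<close> and
      \<open>w\<close> vanish.\<close>
    have key: "v * (1 + x * w) * (1 + x * v) + (1 + x * w) * (w * (x * v))
        = (1 + x * w) * (1 + x * v) * v + (1 + x * w) * (x * v) * w"
      by (simp add: distrib_left distrib_right mult.assoc xs nilvw br)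
    have xa: "a * x = x * a"
    proof -
      have "T j k * x = x * T j k" for j k
        by (induction k arbitrary: j) (simp_all add: distrib_left distrib_right x)
      then show ?thesis by (simp add: a_def)
    qed
    have axv: "a * (x * v) = x * (v * a)"
      by (metis mult.assoc va xa)
    have "(v + (w + a)) * (B * (1 + x * w) * (1 + x * v))
        = B * (v * (1 + x * w) * (1 + x * v)) + ((w + a) * (B * (1 + x * w))) * (1 + x * v)"
      using vB by (simp only: distrib_right mult.assoc[symmetric])
    also have "\<dots> = B * (v * (1 + x * w) * (1 + x * v)) + B * ((1 + x * w) * ((w + a) * (1 + x * v)))"
      by (simp only: IH mult.assoc)
    also have "(w + a) * (1 + x * v) = w + a + w * (x * v) + x * v * a"
      by (simp add: distrib_left distrib_right axv mult.assoc)
    also have "B * (v * (1 + x * w) * (1 + x * v)) + B * ((1 + x * w) * (w + a + w * (x * v) + x * v * a))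
        = B * (v * (1 + x * w) * (1 + x * v) + (1 + x * w) * (w * (x * v)))
          + B * ((1 + x * w) * (w + a + x * v * a))"
      by (simp add: distrib_left add_ac)
    also have "\<dots> = B * (1 + x * w) * (1 + x * v) * (v + (w + a))"
      unfolding key by (simp add: distrib_left distrib_right mult.assoc add_ac)
    finally show ?thesis
      by (simp add: Suc add.assoc v_def w_def a_def B_def)
  qed
qed simp

text \<open>The relation \<open>\<delta> * x = x * \<delta> + 1\<close> makes
  \<open>\<delta>\<close> act as differentiation by \<open>x\<close>, so its commutator with
  \<open>A\<close> is the derivative of \<open>A\<close>. The factor of lowest index is split off;
  what \<open>E\<close> gains thereby is moved across the product by
  \<open>T_A_commute\<close>.\<close>

lemma derivation_A:
  assumes x: "\<And>k. u k * x = x * u k" and \<delta>u: "\<And>k. \<delta> * u k = u k * \<delta>" and \<delta>x: "\<delta> * x = x * \<delta> + 1"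
  shows "\<delta> * A x i (Suc n) + A x i (Suc n) * E (i + 1) n = E i (Suc n) * A x i (Suc n) + A x i (Suc n) * \<delta>"
proof (induction n arbitrary: i)
  case 0
  have "\<delta> * (x * u i) = x * u i * \<delta> + u i"
    by (metis \<delta>x \<delta>u distrib_right mult.assoc mult_1_left)
  moreover have "u i * (x * u i) = 0"
    by (metis x nil mult.assoc mult_zero_right)
  ultimately show ?case
    by (simp add: distrib_left distrib_right)
next
  case (Suc n)
  define v e t B where "v = u i" and "e = E (i + 2) n" and "t = T (i + 1) (Suc n)"
    and "B = A x (i + 1) (Suc n)"
  have IH: "\<delta> * B + B * e = (t + e) * B + B * \<delta>"
    using Suc[of "i + 1"] by (simp add: B_def e_def t_def add.assoc)
  have ve: "v * e = e * v"
    unfolding v_def e_def by (rule u_E_commute) simp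
  have Tx: "T j k * x = x * T j k" for j k
    by (induction k arbitrary: j) (simp_all add: distrib_left distrib_right x)
  have Ex: "E j k * x = x * E j k" for j k
    by (induction k arbitrary: j) (simp_all add: distrib_left distrib_right Tx del: T.simps)
  have ex: "e * (1 + x * v) = (1 + x * v) * e"
  proof -
    have "e * x * v = x * v * e"
      unfolding e_def Ex by (simp add: mult.assoc ve[unfolded e_def])
    then show ?thesis
      by (simp add: distrib_left distrib_right mult.assoc)
  qed
  have \<delta>v: "\<delta> * (1 + x * v) = (1 + x * v) * \<delta> + v"
  proof -
    have "\<delta> * (x * v) = x * v * \<delta> + v"
      unfolding v_def by (metis \<delta>x \<delta>u distrib_right mult.assoc mult_1_left)
    then show ?thesis
      by (simp add: distrib_left distrib_right add_ac)
  qed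
  \<comment> \<open>The product rule leaves a summand \<open>B * v\<close>. It equals
    \<open>B * (1 + x * v) * v\<close>, which completes \<open>t\<close> to the sum
    \<open>v + t\<close> that commutes with the whole product.\<close>
  have vv: "(1 + x * v) * v = v"
    by (simp add: distrib_right mult.assoc v_def nil)
  have T: "(v + t) * (B * (1 + x * v)) = B * (1 + x * v) * (v + t)"
    using T_A_commute[OF x, of i "Suc (Suc n)"] by (simp add: v_def t_def B_def)
  have 1: "\<delta> * B = (t + e) * B + B * \<delta> - B * e"
    using IH by (simp add: eq_diff_eq)
  have "\<delta> * (B * (1 + x * v)) = (t + e) * B * (1 + x * v) + B * (\<delta> * (1 + x * v)) - B * (e * (1 + x * v))"
    by (simp only: mult.assoc[symmetric] 1 distrib_right left_diff_distrib)
  also have "\<dots> = (t + e) * (B * (1 + x * v)) + B * (1 + x * v) * \<delta> + B * v - B * (1 + x * v) * e"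
    by (simp only: \<delta>v ex) (simp add: algebra_simps)
  finally have "\<delta> * (B * (1 + x * v)) + B * (1 + x * v) * (t + e)
      = (t + e) * (B * (1 + x * v)) + B * (1 + x * v) * \<delta> + (B * v + B * (1 + x * v) * t)"
    by (simp add: distrib_left[of _ t e])
  also have "B * v + B * (1 + x * v) * t = (v + t) * (B * (1 + x * v))"
    unfolding T using vv by (simp add: mult.assoc distrib_left[of _ v t])
  finally show ?case
    by (simp add: v_def t_def e_def B_def add.assoc distrib_left distrib_right add_ac)
qed

text \<open>The term that \<open>derivation_A\<close> subtracts on the right of one factor cancels
  the term that the induction hypothesis produces on the left of the next.\<close>

lemma derivation_S:
  assumes x: "\<And>j k. u k * x j = x j * u k" and \<delta>u: "\<And>k. \<delta> * u k = u k * \<delta>"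
    and \<delta>x: "\<And>j. \<delta> * x j = x j * \<delta> + 1"
  shows "\<delta> * S x i n = E i n * S x i n + S x i n * \<delta>"
proof (induction n arbitrary: i)
  case (Suc n)
  let ?A = "A (x i) i (Suc n)" and ?S = "S x (i + 1) n"
  have "\<delta> * ?A = E i (Suc n) * ?A + ?A * \<delta> - ?A * E (i + 1) n"
    using derivation_A[OF x \<delta>u \<delta>x, of i i n] by (simp only: eq_diff_eq)
  then have "\<delta> * (?A * ?S) = E i (Suc n) * ?A * ?S + ?A * (\<delta> * ?S) - ?A * (E (i + 1) n * ?S)"
    by (simp only: mult.assoc[symmetric] distrib_right left_diff_distrib)
  also have "\<dots> = E i (Suc n) * (?A * ?S) + ?A * ?S * \<delta>"
    unfolding Suc.IH by (simp only: distrib_left mult.assoc) simp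
  finally show ?case
    by (simp only: S.simps)
qed simp

end

section \<open>The ring of additive endomorphisms\<close>

text \<open>A separate type is used so that the product is composition, and additivity is built in
  because left distributivity depends on it.\<close>

typedef (overloaded) ('v::ab_group_add) endo = "{g :: 'v \<Rightarrow> 'v. \<forall>a b. g (a + b) = g a + g b}"
  morphisms app Endo
  by (rule exI[of _ "\<lambda>x. x"]) simp

lemma app_add [simp]: "app g (a + b) = app g a + app g b"
  using app[of g] by simp

lemma endo_eqI: "(\<And>a. app g a = app h a) \<Longrightarrow> g = h"
  by (simp add: app_inject[symmetric] fun_eq_iff)

lemma app_Endo: "(\<And>a b. g (a + b) = g a + g b) \<Longrightarrow> app (Endo g) = g"
  by (simp add: Endo_inverse)

instantiation endo :: (ab_group_add) "{ring,monoid_mult}"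
begin

definition "0 = Endo (\<lambda>_. 0)"
definition "1 = Endo (\<lambda>a. a)"
definition "g + h = Endo (\<lambda>a. app g a + app h a)"
definition "- g = Endo (\<lambda>a. - app g a)"
definition "g - h = Endo (\<lambda>a. app g a - app h a)"
definition "g * h = Endo (\<lambda>a. app g (app h a))"

lemma app_ring [simp]:
  "app 0 a = 0" "app 1 a = a" "app (g + h) a = app g a + app h a" "app (- g) a = - app g a"
  "app (g - h) a = app g a - app h a" "app (g * h) a = app g (app h a)"
  by (simp_all add: zero_endo_def one_endo_def plus_endo_def uminus_endo_def minus_endo_def
      times_endo_def app_Endo)

instance
  by standard (auto intro!: endo_eqI simp: add.assoc)

end

section \<open>Reduced words\<close>

abbreviation adj :: "int \<Rightarrow> int \<Rightarrow> int" where
  "adj k \<equiv> transpose k (k + 1)"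

definition inversions :: "(int \<Rightarrow> int) \<Rightarrow> (int \<times> int) set" where
  "inversions w = {(a, b). a < b \<and> w b < w a}"

text \<open>Requiring \<open>bij w\<close> rules out functions at which \<open>inv w\<close> has no
  meaning, so that the nilCoxeter relations of the operators below hold at every function.\<close>

definition left_descent :: "(int \<Rightarrow> int) \<Rightarrow> int \<Rightarrow> bool" where
  "left_descent w k \<longleftrightarrow> bij w \<and> inv w (k + 1) < inv w k"

lemma adj_adj_comp [simp]: "adj k \<circ> (adj k \<circ> w) = w"
  by (simp add: fun_eq_iff)

lemma bij_adj_comp_iff [simp]: "bij (adj k \<circ> w) \<longleftrightarrow> bij w"
proof
  assume "bij (adj k \<circ> w)"
  from bij_comp[OF this, of "adj k"] show "bij w" by simp
qed (simp add: bij_comp)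

lemma inv_adj_comp: "bij w \<Longrightarrow> inv (adj k \<circ> w) j = inv w (adj k j)"
  by (simp add: o_inv_distrib)

lemma left_descent_adj_comp:
  "bij w \<Longrightarrow> left_descent (adj k \<circ> w) k \<longleftrightarrow> \<not> left_descent w k"
  using bij_is_inj[OF bij_imp_bij_inv, of w]
  by (auto simp: left_descent_def inv_adj_comp inj_eq dest: order_less_asym)
    (metis inj_eq less_linear add_cancel_left_right zero_neq_one)

text \<open>Exchanging the values \<open>k\<close> and \<open>k + 1\<close> reverses the order of no
  other pair of values, so only the pair of their positions changes status.\<close>

lemma inversions_adj_comp:
  assumes w: "bij w" and nd: "\<not> left_descent w k"
  shows "inversions (adj k \<circ> w) = insert (inv w k, inv w (k + 1)) (inversions w)"
    and "(inv w k, inv w (k + 1)) \<notin> inversions w"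
proof -
  have winv: "w (inv w j) = j" for j
    by (meson bij_inv_eq_iff w)
  have "inv w k \<noteq> inv w (k + 1)"
    by (metis winv add_cancel_left_right zero_neq_one)
  with w nd have lt: "inv w k < inv w (k + 1)"
    by (auto simp: left_descent_def)
  show "(inv w k, inv w (k + 1)) \<notin> inversions w"
    by (simp add: inversions_def winv)
  have weq: "w a = j \<longleftrightarrow> a = inv w j" for a j
    by (metis bij_inv_eq_iff w)
  have swap: "adj k y < adj k x \<longleftrightarrow> (x = k \<and> y = k + 1) \<or> (y < x \<and> \<not> (x = k + 1 \<and> y = k))"
    for x y
    by (auto simp: transpose_def)
  show "inversions (adj k \<circ> w) = insert (inv w k, inv w (k + 1)) (inversions w)"
    using lt by (auto simp: inversions_def swap weq)
qed

lemma card_inversions_adj_comp: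
  assumes w: "bij w" and fin: "finite (inversions w)"
  shows "finite (inversions (adj k \<circ> w))"
    and "\<not> left_descent w k \<Longrightarrow> card (inversions (adj k \<circ> w)) = Suc (card (inversions w))"
    and "left_descent w k \<Longrightarrow> Suc (card (inversions (adj k \<circ> w))) = card (inversions w)"
proof -
  have *: "finite (inversions (adj k \<circ> w)) \<and> card (inversions (adj k \<circ> w)) = Suc (card (inversions w))"
    if "\<not> left_descent w k"
    using inversions_adj_comp[OF w that] fin by simp
  have **: "finite (inversions (adj k \<circ> w)) \<and> Suc (card (inversions (adj k \<circ> w))) = card (inversions w)"
    if "left_descent w k"
  proof -
    have nd: "\<not> left_descent (adj k \<circ> w) k"
      using that left_descent_adj_comp[OF w] by simp
    have "bij (adj k \<circ> w)" using w by simp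
    from inversions_adj_comp[OF this nd] fin show ?thesis
      by (simp only: adj_adj_comp) simp
  qed
  show "finite (inversions (adj k \<circ> w))" using * ** by blast
  show "\<not> left_descent w k \<Longrightarrow> card (inversions (adj k \<circ> w)) = Suc (card (inversions w))"
    using * by blast
  show "left_descent w k \<Longrightarrow> Suc (card (inversions (adj k \<circ> w))) = card (inversions w)"
    using ** by blast
qed

section \<open>Words in adjacent transpositions, length and inversions\<close>

lemma word_perm_Nil [simp]: "word_perm [] = id"
  and word_perm_Cons [simp]: "word_perm (k # ws) = adj k \<circ> word_perm ws"
  by (simp_all add: word_perm_def)

lemma bij_word_perm [simp]: "bij (word_perm ws)"
  by (induction ws) (simp_all only: word_perm_Nil word_perm_Cons bij_id bij_adj_comp_iff)

lemma inversions_word_perm: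
  "finite (inversions (word_perm ws)) \<and> card (inversions (word_perm ws)) \<le> length ws"
proof (induction ws)
  case Nil
  have "inversions (word_perm []) = {}" by (auto simp: inversions_def)
  then show ?case by (simp only: finite.emptyI card.empty) simp
next
  case (Cons k ws)
  then have "finite (inversions (word_perm ws))" by simp
  note * = card_inversions_adj_comp[OF bij_word_perm this, of k]
  have "card (inversions (adj k \<circ> word_perm ws)) \<le> Suc (length ws)"
    using *(2,3) Cons by linarith
  with *(1) show ?case
    by (simp only: word_perm_Cons length_Cons simp_thms)
qed

lemma word_perm_far: "\<exists>N. \<forall>i. \<bar>i\<bar> > N \<longrightarrow> word_perm ws i = i"
proof (induction ws)
  case (Cons k ws)
  then obtain N where N: "\<And>i. \<bar>i\<bar> > N \<Longrightarrow> word_perm ws i = i" by blast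
  show ?case
    by (rule exI[of _ "max N (\<bar>k\<bar> + 1)"]) (auto simp: N transpose_def)
qed simp

text \<open>Without descents the inverse never shrinks distances. It fixes far points on both sides,
  which squeezes every point in between onto itself.\<close>

lemma mono_bij_eq_id:
  assumes w: "bij w" and far: "\<And>i. \<bar>i\<bar> > N \<Longrightarrow> w i = i" and nd: "\<And>k. \<not> left_descent w k"
  shows "w = id"
proof -
  define v where "v = inv w"
  have v: "v (k + 1) \<ge> v k + 1" for k
  proof -
    have "v k \<noteq> v (k + 1)"
      by (metis v_def bij_inv_eq_iff w add_cancel_left_right zero_neq_one)
    then show ?thesis
      using nd[of k] w by (auto simp: left_descent_def v_def)
  qed
  have vn: "v (k + int n) \<ge> v k + int n" for k n
  proof (induction n)
    case (Suc n)
    then show ?case using v[of "k + int n"] by (simp add: add.assoc add.commute[of 1])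
  qed simp
  have vmono: "v j - v i \<ge> j - i" if "i \<le> j" for i j
    using vn[of i "nat (j - i)"] that by simp
  have vfar: "v i = i" if "\<bar>i\<bar> > N" for i
    using far[OF that] w by (metis v_def bij_inv_eq_iff)
  have "v i = i" for i
  proof -
    define M where "M = \<bar>N\<bar> + \<bar>i\<bar> + 1"
    have "v M = M" "v (- M) = - M" by (auto intro!: vfar simp: M_def)
    moreover have "i \<le> M" "- M \<le> i" by (auto simp: M_def)
    ultimately show ?thesis
      using vmono[of i M] vmono[of "- M" i] by simp
  qed
  then show ?thesis
    using w by (metis v_def bij_inv_eq_iff eq_id_iff)
qed

text \<open>Prepending a descent removes one inversion, and prepending it once more undoes the
  change; without descents only the identity is left. Stating this for \<open>word_perm vs\<close>
  supplies bijectivity and finite support throughout the induction.\<close>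

lemma word_of_length_inversions:
  "\<exists>ws. word_perm ws = word_perm vs \<and> length ws = card (inversions (word_perm vs))"
proof (induction "card (inversions (word_perm vs))" arbitrary: vs rule: less_induct)
  case less
  show ?case
  proof (cases "\<exists>k. left_descent (word_perm vs) k")
    case True
    then obtain k where k: "left_descent (word_perm vs) k" by blast
    have card: "Suc (card (inversions (word_perm (k # vs)))) = card (inversions (word_perm vs))"
      using card_inversions_adj_comp(3)[OF bij_word_perm _ k] inversions_word_perm by simp
    then obtain ws where ws: "word_perm ws = word_perm (k # vs)"
        "length ws = card (inversions (word_perm (k # vs)))"
      using less[of "k # vs"] by (metis lessI)
    then have "word_perm (k # ws) = word_perm vs" by simp
    with ws card show ?thesis by (metis length_Cons)
  next
    case False
    obtain N where "\<And>i. \<bar>i\<bar> > N \<Longrightarrow> word_perm vs i = i"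
      using word_perm_far by blast
    with False have "word_perm vs = id"
      by (intro mono_bij_eq_id) auto
    moreover have "inversions id = {}" by (auto simp: inversions_def)
    ultimately show ?thesis by (intro exI[of _ "[]"]) simp
  qed
qed

lemma reduced_words_iff:
  "ws \<in> reduced_words w \<longleftrightarrow> word_perm ws = w \<and> length ws = card (inversions w)"
proof
  assume "ws \<in> reduced_words w"
  then have "word_perm ws = w" "\<And>vs. word_perm vs = w \<Longrightarrow> length ws \<le> length vs"
    by (auto simp: reduced_words_def)
  then show "word_perm ws = w \<and> length ws = card (inversions w)"
    using inversions_word_perm[of ws] word_of_length_inversions[of ws] by (metis antisym)
next
  assume "word_perm ws = w \<and> length ws = card (inversions w)"
  then show "ws \<in> reduced_words w"
    unfolding reduced_words_def mem_Collect_eq using inversions_word_perm by metis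
qed

lemma Nil_in_reduced_words_iff: "[] \<in> reduced_words w \<longleftrightarrow> w = id"
  by (auto simp: reduced_words_def)

text \<open>Prefixing a letter to a reduced word keeps it reduced exactly when the number of
  inversions rises. This recursion is what the operators \<open>weak_op\<close> imitate.\<close>

lemma Cons_in_reduced_words_iff:
  "k # v \<in> reduced_words w \<longleftrightarrow> left_descent w k \<and> v \<in> reduced_words (adj k \<circ> w)"
proof
  assume "k # v \<in> reduced_words w"
  then have w: "w = adj k \<circ> word_perm v" and len: "Suc (length v) = card (inversions w)"
    by (auto simp: reduced_words_iff)
  have bw: "bij w" using w by simp
  have fin: "finite (inversions w)"
    using inversions_word_perm[of "k # v"] w by simp
  have v: "word_perm v = adj k \<circ> w" using w by simp
  have "left_descent w k"
  proof (rule ccontr)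
    assume "\<not> left_descent w k"
    from card_inversions_adj_comp(2)[OF bw fin this] inversions_word_perm[of v] len v
    show False by simp
  qed
  with card_inversions_adj_comp(3)[OF bw fin this] len v
  show "left_descent w k \<and> v \<in> reduced_words (adj k \<circ> w)"
    by (simp add: reduced_words_iff)
next
  assume *: "left_descent w k \<and> v \<in> reduced_words (adj k \<circ> w)"
  then have v: "word_perm v = adj k \<circ> w" "length v = card (inversions (adj k \<circ> w))"
    by (auto simp: reduced_words_iff)
  then have w: "w = word_perm (k # v)" by simp
  have "finite (inversions w)"
    unfolding w using inversions_word_perm by blast
  moreover have "bij w" using * by (simp add: left_descent_def)
  ultimately have "Suc (length v) = card (inversions w)"
    using card_inversions_adj_comp(3) * v(2) by metis
  then show "k # v \<in> reduced_words w"
    unfolding reduced_words_iff using w by (metis length_Cons)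
qed

text \<open>A letter stops being a descent once it has been stripped. On color-1 words this turns
  weakly decreasing factors into strictly decreasing ones.\<close>

lemma distinct_adj_reduced_word: "ws \<in> reduced_words w \<Longrightarrow> distinct_adj ws"
proof (induction ws arbitrary: w)
  case (Cons k v)
  then have k: "left_descent w k" and v: "v \<in> reduced_words (adj k \<circ> w)"
    by (auto simp: Cons_in_reduced_words_iff)
  have "bij w" using k by (simp add: left_descent_def)
  show ?case
  proof (cases v)
    case (Cons j v')
    with v have "left_descent (adj k \<circ> w) j"
      by (simp add: Cons_in_reduced_words_iff)
    with k left_descent_adj_comp[OF \<open>bij w\<close>] have "j \<noteq> k" by auto
    with Cons.IH[OF v] \<open>v = j # v'\<close> show ?thesis by simp
  qed simp
qed simp

lemma reduced_word_letters:
  assumes "ws \<in> reduced_words w" "\<And>i. \<bar>i\<bar> > N \<Longrightarrow> w i = i"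
  shows "set ws \<subseteq> {-N..N}"
  using assms
proof (induction ws arbitrary: w)
  case (Cons k v)
  then have k: "left_descent w k" and v: "v \<in> reduced_words (adj k \<circ> w)"
    by (auto simp: Cons_in_reduced_words_iff)
  then have w: "bij w" by (simp add: left_descent_def)
  have winv: "w (inv w j) = j" for j
    by (meson bij_inv_eq_iff w)
  have far: "inv w i = i" if "\<bar>i\<bar> > N" for i
    using Cons.prems(2)[OF that] w by (metis bij_inv_eq_iff)
  have near: "\<bar>inv w i\<bar> \<le> N" if "\<bar>i\<bar> \<le> N" for i
    using Cons.prems(2)[of "inv w i"] that winv[of i] by fastforce
  have lt: "inv w (k + 1) < inv w k" using k by (simp add: left_descent_def)
  \<comment> \<open>If \<open>k\<close> or \<open>k + 1\<close> lay outside \<open>{-N..N}\<close>,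
    the fixed points there would place \<open>k\<close> before \<open>k + 1\<close>, against the
    descent.\<close>
  have kN: "\<bar>k\<bar> \<le> N \<and> \<bar>k + 1\<bar> \<le> N"
  proof (cases "\<bar>k\<bar> \<le> N"; cases "\<bar>k + 1\<bar> \<le> N")
    assume "\<bar>k\<bar> \<le> N" "\<not> \<bar>k + 1\<bar> \<le> N"
    with near[of k] far[of "k + 1"] lt show ?thesis by arith
  next
    assume "\<not> \<bar>k\<bar> \<le> N" "\<bar>k + 1\<bar> \<le> N"
    with near[of "k + 1"] far[of k] lt show ?thesis by arith
  next
    assume "\<not> \<bar>k\<bar> \<le> N" "\<not> \<bar>k + 1\<bar> \<le> N"
    with far[of "k + 1"] far[of k] lt show ?thesis by arith
  qed simp
  have "(adj k \<circ> w) i = i" if "\<bar>i\<bar> > N" for i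
    using Cons.prems(2)[OF that] that kN by (auto simp: transpose_def)
  from Cons.IH[OF v this] kN show ?case by auto
qed simp

lemma finite_reduced_words: "finite (reduced_words w)"
proof (cases "reduced_words w = {}")
  case False
  then obtain vs where "word_perm vs = w" by (auto simp: reduced_words_def)
  then obtain N where N: "\<And>i. \<bar>i\<bar> > N \<Longrightarrow> w i = i"
    using word_perm_far by blast
  have "reduced_words w \<subseteq> {ws. set ws \<subseteq> {-N..N} \<and> length ws = card (inversions w)}"
    using reduced_word_letters[of _ w N] N reduced_words_iff by blast
  then show ?thesis
    by (rule finite_subset) (rule finite_lists_length_eq, simp)
qed simp

section \<open>Polynomials and the total derivative\<close>

text \<open>Monomials in the variables \<open>x\<^sub>i\<close> with \<open>i \<in> \<int>\<close> are finite multisets of integers.\<close>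

type_synonym mpoly = "int multiset \<Rightarrow>\<^sub>0 rat"

abbreviation var :: "int \<Rightarrow> mpoly" where
  "var i \<equiv> basis {#i#}"

lemma basis_induct [case_names basis add scale]:
  assumes "\<And>p. P (basis p)" "\<And>a b. P a \<Longrightarrow> P b \<Longrightarrow> P (a + b)" "\<And>c a. P a \<Longrightarrow> P (scale c a)"
  shows "P a"
proof -
  have 0: "P 0" using assms(3)[OF assms(1), of 0] by simp
  have "P (\<Sum>p\<in>F. scale (f p) (basis p))" if "finite F" for F f
    using that by (induction F rule: finite_induct) (simp_all add: 0 assms)
  then have "P (lin_ext basis a)" unfolding lin_ext_def by simp
  then show ?thesis by (simp only: lin_ext_id)
qed

lemma lin_ext_zero [simp]: "lin_ext f 0 = 0"
  by (simp add: lin_ext_def)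

lemma lin_ext_sum: "lin_ext f (\<Sum>i\<in>F. h i) = (\<Sum>i\<in>F. lin_ext f (h i))"
  by (induction F rule: infinite_finite_induct) (simp_all add: lin_ext_add)

lemma lin_ext_sum_list: "lin_ext f (sum_list as) = (\<Sum>a\<leftarrow>as. lin_ext f a)"
  by (induction as) (simp_all add: lin_ext_add)

lemma scale_eq_times: "scale c a = Poly_Mapping.single 0 c * a"
  for a :: "'a::cancel_comm_monoid_add \<Rightarrow>\<^sub>0 rat"
  by (simp add: scale_def mult_map_scale_conv_mult)

lemma scale_times_left: "scale c a * b = scale c (a * b)"
  and scale_times_right: "a * scale c b = scale c (a * b)"
  for a b :: "'a::cancel_comm_monoid_add \<Rightarrow>\<^sub>0 rat"
  by (simp_all only: scale_eq_times mult.assoc mult.left_commute)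

lemma basis_times_basis: "basis X * basis Y = basis (X + Y)"
  for X Y :: "'a::comm_monoid_add"
  by (simp add: mult_single)

text \<open>Summation over the multiset counts repetitions, which supplies the exponents of the
  partial derivatives.\<close>

definition total_deriv :: "mpoly \<Rightarrow> mpoly" where
  "total_deriv = lin_ext (\<lambda>X. \<Sum>i\<in>#X. basis (X - {#i#}))"

lemma total_deriv_zero [simp]: "total_deriv 0 = 0"
  and total_deriv_add: "total_deriv (a + b) = total_deriv a + total_deriv b"
  and total_deriv_scale: "total_deriv (scale c a) = scale c (total_deriv a)"
  by (simp_all add: total_deriv_def lin_ext_add lin_ext_scale)

lemma total_deriv_basis: "total_deriv (basis X) = (\<Sum>i\<in>#X. basis (X - {#i#}))"
  by (simp add: total_deriv_def)

lemma total_deriv_one [simp]: "total_deriv 1 = 0"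
proof -
  have "(1::mpoly) = basis {#}" by (metis single_one zero_multiset_def)
  then have "total_deriv 1 = total_deriv (basis {#})" by (rule arg_cong)
  then show ?thesis by (simp only: total_deriv_basis) simp
qed

lemma total_deriv_var [simp]: "total_deriv (var i) = 1"
  by (simp add: total_deriv_basis)

lemma total_deriv_mult: "total_deriv (a * b) = total_deriv a * b + a * total_deriv b"
proof (induction a rule: basis_induct)
  case (basis X)
  show ?case
  proof (induction b rule: basis_induct)
    case (basis Y)
    have *: "(\<Sum>i\<in>#Z. basis (Z + W - {#i#})) = (\<Sum>i\<in>#Z. basis (Z - {#i#})) * basis W"
      for Z W :: "int multiset"
    proof -
      have "(\<Sum>i\<in>#Z. basis (Z + W - {#i#})) = (\<Sum>i\<in>#Z. basis (Z - {#i#}) * (basis W :: mpoly))"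
        by (intro arg_cong[of _ _ sum_mset] image_mset_cong)
          (auto simp: basis_times_basis dest!: multi_member_split)
      then show ?thesis by (simp add: sum_mset_distrib_right)
    qed
    show ?case
      unfolding basis_times_basis total_deriv_basis image_mset_union sum_mset.union
      by (simp only: *[of X Y] *[of Y X, unfolded add.commute[of Y X]] mult.commute[of "basis X"])
  qed (simp_all add: total_deriv_add total_deriv_scale distrib_left scale_times_right
      Q.scale_right_distrib)
qed (simp_all add: total_deriv_add total_deriv_scale distrib_right scale_times_left
      Q.scale_right_distrib)

section \<open>Convolution of functions on words\<close>

text \<open>This evaluates \<open>h\<close> on the deconcatenation of a word. Letters already passed
  are absorbed into \<open>h\<close>, so inductions generalize over \<open>h\<close>.\<close>

fun split_sum :: "('a list \<Rightarrow> 'a list \<Rightarrow> 'k::comm_monoid_add) \<Rightarrow> 'a list \<Rightarrow> 'k" where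
  "split_sum h [] = h [] []"
| "split_sum h (x # p) = h [] (x # p) + split_sum (\<lambda>p1. h (x # p1)) p"

lemma split_sum_cong:
  "(\<And>p1 p2. p = p1 @ p2 \<Longrightarrow> h p1 p2 = h' p1 p2) \<Longrightarrow> split_sum h p = split_sum h' p"
proof (induction p arbitrary: h h')
  case Nil
  from Nil[of "[]" "[]"] show ?case by simp
next
  case (Cons x p)
  from Cons.prems have "split_sum (\<lambda>p1. h (x # p1)) p = split_sum (\<lambda>p1. h' (x # p1)) p"
    by (intro Cons.IH) simp
  with Cons.prems[of "[]" "x # p"] show ?case by simp
qed

lemma split_sum_add:
  "split_sum (\<lambda>p1 p2. h p1 p2 + h' p1 p2) p = split_sum h p + split_sum h' p"
  by (induction p arbitrary: h h') (simp_all add: add_ac)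

lemma split_sum_zero [simp]: "split_sum (\<lambda>p1 p2. 0) p = 0"
  by (induction p) simp_all

lemma split_sum_mult_left: "split_sum (\<lambda>p1 p2. c * h p1 p2) p = c * split_sum h p"
  for c :: "'k::comm_semiring_1"
  by (induction p arbitrary: h) (simp_all add: distrib_left)

lemma split_sum_mult_right: "split_sum (\<lambda>p1 p2. h p1 p2 * c) p = split_sum h p * c"
  for c :: "'k::comm_semiring_1"
  by (induction p arbitrary: h) (simp_all add: distrib_right)

lemma split_sum_map:
  "split_sum h (map f p) = split_sum (\<lambda>p1 p2. h (map f p1) (map f p2)) p"
  by (induction p arbitrary: h) simp_all

definition shuffle_sum :: "('a list \<Rightarrow> 'k::comm_monoid_add) \<Rightarrow> 'a list \<Rightarrow> 'a list \<Rightarrow> 'k" where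
  "shuffle_sum h p q = (\<Sum>r\<leftarrow>interlacings p q. h r)"

lemma interlacings_Nil2 [simp]: "interlacings p [] = [p]"
  by (cases p) simp_all

lemma shuffle_sum_simps [simp]:
  "shuffle_sum h [] q = h q" "shuffle_sum h p [] = h p"
  "shuffle_sum h (x # p) (y # q) =
     shuffle_sum (\<lambda>r. h (x # r)) p (y # q) + shuffle_sum (\<lambda>r. h (y # r)) (x # p) q"
  by (simp_all add: shuffle_sum_def o_def)

lemma shuffle_sum_add: "shuffle_sum (\<lambda>r. h r + h' r) p q = shuffle_sum h p q + shuffle_sum h' p q"
  unfolding shuffle_sum_def by (simp add: sum_list_addf)

lemma shuffle_sum_cong:
  "(\<And>r. mset r = mset p + mset q \<Longrightarrow> h r = h' r) \<Longrightarrow> shuffle_sum h p q = shuffle_sum h' p q"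
proof (induction p q arbitrary: h h' rule: interlacings.induct)
  case (3 x p y q)
  have "shuffle_sum (\<lambda>r. h (x # r)) p (y # q) = shuffle_sum (\<lambda>r. h' (x # r)) p (y # q)"
    by (intro 3(1) 3(3)) simp
  moreover have "shuffle_sum (\<lambda>r. h (y # r)) (x # p) q = shuffle_sum (\<lambda>r. h' (y # r)) (x # p) q"
    by (intro 3(2) 3(3)) simp
  ultimately show ?case by simp
qed simp_all

lemma shuffle_sum_mult_left: "shuffle_sum (\<lambda>r. c * h r) p q = c * shuffle_sum h p q"
  for c :: "'k::comm_semiring_1"
  by (simp add: shuffle_sum_def sum_list_const_mult)

lemma shuffle_sum_mult_right: "shuffle_sum (\<lambda>r. h r * c) p q = shuffle_sum h p q * c"
  for c :: "'k::comm_semiring_1"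
  by (simp add: shuffle_sum_def sum_list_mult_const)

text \<open>Deconcatenation is multiplicative for the shuffle product.\<close>

lemma shuffle_sum_split_sum:
  "shuffle_sum (split_sum h) p q =
     split_sum (\<lambda>p1 p2. split_sum (\<lambda>q1 q2.
       shuffle_sum (\<lambda>r1. shuffle_sum (h r1) p2 q2) p1 q1) q) p"
proof (induction p q arbitrary: h rule: interlacings.induct)
  case (3 x p y q)
  show ?case
    by (simp add: shuffle_sum_add 3 split_sum_add add_ac)
next
  case (1 q)
  show ?case by simp (intro split_sum_cong, simp)
qed simp

text \<open>A convolution of two characters of the shuffle product is again a character.
  Multiplicativity is asked only for words without common letters, a condition that factors of the
  words inherit.\<close>

lemma shuffle_sum_split_sum_mult:
  fixes f g :: "'a list \<Rightarrow> 'k::comm_semiring_1"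
  assumes f: "\<And>p q. set p \<inter> set q = {} \<Longrightarrow> shuffle_sum f p q = f p * f q"
    and g: "\<And>p q. set p \<inter> set q = {} \<Longrightarrow> shuffle_sum g p q = g p * g q"
    and pq: "set p \<inter> set q = {}"
  shows "shuffle_sum (split_sum (\<lambda>r s. f r * g s)) p q =
    split_sum (\<lambda>r s. f r * g s) p * split_sum (\<lambda>r s. f r * g s) q"
proof -
  have "shuffle_sum (split_sum (\<lambda>r s. f r * g s)) p q =
     split_sum (\<lambda>p1 p2. split_sum (\<lambda>q1 q2. (f p1 * g p2) * (f q1 * g q2)) q) p"
    unfolding shuffle_sum_split_sum
    using pq by (intro split_sum_cong)
      (auto simp: shuffle_sum_mult_left shuffle_sum_mult_right f g mult_ac Int_Un_distrib Int_Un_distrib2)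
  then show ?thesis
    by (simp only: split_sum_mult_left split_sum_mult_right)
qed

text \<open>Two decreasing words without common letters have exactly one decreasing interlacing; a
  common letter would give several coinciding ones.\<close>

lemma shuffle_sum_decreasing:
  fixes p q :: "'a::linorder list"
  assumes "set p \<inter> set q = {}"
  shows "shuffle_sum (\<lambda>r. of_bool (sorted_wrt (\<ge>) r)) p q
    = (of_bool (sorted_wrt (\<ge>) p) * of_bool (sorted_wrt (\<ge>) q) :: 'k::comm_semiring_1)"
  using assms
proof (induction p q rule: interlacings.induct)
  case (3 x p y q)
  have *: "shuffle_sum (\<lambda>r. of_bool (sorted_wrt (\<ge>) (z # r))) p' q' =
      (of_bool (\<forall>a\<in>set p' \<union> set q'. a \<le> z) :: 'k) * shuffle_sum (\<lambda>r. of_bool (sorted_wrt (\<ge>) r)) p' q'"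
    for z and p' q' :: "'a list"
    unfolding shuffle_sum_mult_left[symmetric]
  proof (intro shuffle_sum_cong)
    fix r assume "mset r = mset p' + mset q'"
    then have "set r = set p' \<union> set q'"
      by (metis set_mset_mset set_mset_union)
    then show "of_bool (sorted_wrt (\<ge>) (z # r)) =
        (of_bool (\<forall>a\<in>set p' \<union> set q'. a \<le> z) * of_bool (sorted_wrt (\<ge>) r) :: 'k)"
      by simp
  qed
  show ?case
  proof -
    have IH: "shuffle_sum (\<lambda>r. of_bool (sorted_wrt (\<ge>) r)) p (y # q)
          = (of_bool (sorted_wrt (\<ge>) p) * of_bool (sorted_wrt (\<ge>) (y # q)) :: 'k)"
        "shuffle_sum (\<lambda>r. of_bool (sorted_wrt (\<ge>) r)) (x # p) q
          = (of_bool (sorted_wrt (\<ge>) (x # p)) * of_bool (sorted_wrt (\<ge>) q) :: 'k)"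
      using 3 by auto
    \<comment> \<open>Only interlacings that start with the larger of the two first letters can be
      decreasing, so one of the two summands vanishes.\<close>
    have "x \<noteq> y" using 3(3) by auto
    then consider "x < y" | "y < x" by fastforce
    then show ?thesis
      unfolding shuffle_sum_simps(3) * IH
      by cases (auto simp: of_bool_def, (meson less_imp_le order_trans)+)
  qed
qed simp_all


section \<open>Truncated slide polynomials\<close>

text \<open>The part of a compatible sequence that equals \<open>i\<close> sits over a weakly decreasing factor of the
  word, hence a slide polynomial is a convolution of the characters \<open>block\<close>, one for each variable.
  Variables run through \<open>i, \<dots>, i + n - 1\<close> and words with a letter outside of this range are sent
  to \<open>0\<close>.\<close>

definition block :: "int \<Rightarrow> nat \<Rightarrow> cword \<Rightarrow> mpoly" where
  "block i n p = of_bool (sorted_wrt (\<ge>) p) *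
     (of_bool (\<forall>y\<in>set p. i \<le> val y \<and> val y < i + int n) * var i ^ length p)"

fun slide :: "int \<Rightarrow> nat \<Rightarrow> cword \<Rightarrow> mpoly" where
  "slide i 0 p = of_bool (p = [])"
| "slide i (Suc n) p = split_sum (\<lambda>r s. block i (Suc n) r * slide (i + 1) n s) p"

text \<open>On words with first letter in range this is \<open>slide\<close> after
  \<open>\<nabla> + (1 - i) \<xi>\<close>; the shift makes the weights those of the element
  \<open>E\<close> of the nilCoxeter algebra.\<close>

definition slide_nabla :: "int \<Rightarrow> nat \<Rightarrow> cword \<Rightarrow> mpoly" where
  "slide_nabla i n p = (case p of [] \<Rightarrow> 0 | y # p' \<Rightarrow>
     if i \<le> val y \<and> val y < i + int n then scale (of_int (val y - i + 1)) (slide i n p') else 0)"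

text \<open>All interlacings have the same letters and the same length, so only the test for
  decrease depends on the interlacing.\<close>

lemma shuffle_sum_block:
  assumes "set p \<inter> set q = {}"
  shows "shuffle_sum (block i n) p q = block i n p * block i n q"
proof -
  have "shuffle_sum (block i n) p q = shuffle_sum (\<lambda>r. of_bool (sorted_wrt (\<ge>) r) *
      (of_bool (\<forall>y\<in>set p \<union> set q. i \<le> val y \<and> val y < i + int n) * var i ^ (length p + length q))) p q"
    unfolding block_def
  proof (intro shuffle_sum_cong)
    fix r assume r: "mset r = mset p + mset q"
    then have "set r = set p \<union> set q" by (metis set_mset_mset set_mset_union)
    moreover have "length r = length p + length q" using r by (metis size_mset size_union)
    ultimately show "of_bool (sorted_wrt (\<lambda>x y. y \<le> x) r) * (of_bool (\<forall>y\<in>set r. i \<le> val y \<and> val y < i + int n) * var i ^ length r) =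
         of_bool (sorted_wrt (\<lambda>x y. y \<le> x) r) * (of_bool (\<forall>y\<in>set p \<union> set q. i \<le> val y \<and> val y < i + int n) * var i ^ (length p + length q))"
      by simp
  qed
  also have "\<dots> = block i n p * block i n q"
    unfolding shuffle_sum_mult_right shuffle_sum_decreasing[OF assms]
    by (auto simp: block_def power_add ball_Un)
  finally show ?thesis .
qed

lemma slide_Nil [simp]: "slide i n [] = 1"
  by (induction n arbitrary: i) (simp_all add: block_def)

lemma shuffle_sum_slide:
  "set p \<inter> set q = {} \<Longrightarrow> shuffle_sum (slide i n) p q = slide i n p * slide i n q"
proof (induction n arbitrary: i p q)
  case 0
  then show ?case
    by (cases p; cases q) (simp_all add: shuffle_sum_def o_def)
next
  case (Suc n)
  have "slide i (Suc n) = split_sum (\<lambda>r s. block i (Suc n) r * slide (i + 1) n s)"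
    by (simp add: fun_eq_iff)
  then show ?case
    using shuffle_sum_split_sum_mult[OF shuffle_sum_block Suc.IH Suc.prems] by simp
qed

lemma shuffle_sum_scale:
  "shuffle_sum (\<lambda>r. scale c (h r)) p q = scale c (shuffle_sum h p q)"
  by (induction p q arbitrary: h rule: interlacings.induct) (simp_all add: Q.scale_right_distrib)

text \<open>An interlacing starts with the first letter of \<open>p\<close> or of \<open>q\<close>;
  stripping it leaves a shuffle, on which \<open>slide\<close> is multiplicative. So
  \<open>slide_nabla\<close> is a derivation over \<open>slide\<close>.\<close>

lemma shuffle_sum_slide_nabla:
  assumes "set p \<inter> set q = {}"
  shows "shuffle_sum (slide_nabla i n) p q =
    slide_nabla i n p * slide i n q + slide i n p * slide_nabla i n q"
proof -
  have *: "shuffle_sum (\<lambda>r. slide_nabla i n (x # r)) p' q' =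
      slide_nabla i n (x # p') * slide i n q'" if "set p' \<inter> set q' = {}" for x p' q'
  proof (cases "i \<le> val x \<and> val x < i + int n")
    case True
    then show ?thesis
      using that by (simp add: slide_nabla_def shuffle_sum_scale shuffle_sum_slide scale_times_left)
  next
    case False
    have "shuffle_sum (\<lambda>r. 0 :: mpoly) p' q' = 0"
      by (simp add: shuffle_sum_def)
    then show ?thesis using False by (auto simp: slide_nabla_def)
  qed
  show ?thesis
  proof (cases p)
    case Nil
    then show ?thesis by (simp add: slide_nabla_def)
  next
    case p: (Cons x p')
    show ?thesis
    proof (cases q)
      case Nil
      then show ?thesis by (simp add: slide_nabla_def)
    next
      case q: (Cons y q')
      have "shuffle_sum (\<lambda>r. slide_nabla i n (x # r)) p' q = slide_nabla i n p * slide i n q"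
        using assms by (simp add: p *)
      moreover have "shuffle_sum (\<lambda>r. slide_nabla i n (y # r)) p q' = slide i n p * slide_nabla i n q"
      proof -
        have "shuffle_sum h p q' = shuffle_sum h q' p" for h :: "cword \<Rightarrow> mpoly"
          by (induction p q' arbitrary: h rule: interlacings.induct) (simp_all add: add.commute)
        then show ?thesis
          using assms by (subst mult.commute) (simp add: q * Int_commute)
      qed
      ultimately show ?thesis by (simp add: p q)
    qed
  qed
qed

subsection \<open>Raising colors\<close>

lemma val_raise: "val (letter (val x) (col x + a)) = val x"
  using col_pos[of x] by simp

lemma raise_le_iff:
  "letter (val x) (col x + a) \<le> letter (val y) (col y + a) \<longleftrightarrow> x \<le> y"
  using col_pos[of x] col_pos[of y] by (auto simp: less_eq_letter_def)

lemma block_raise: "block i n (p \<up> a) = block i n p"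
  by (simp add: block_def raise_col_def sorted_wrt_map raise_le_iff val_raise)

text \<open>A uniform shift of colors preserves values and all comparisons within a word.\<close>

lemma slide_raise: "slide i n (p \<up> a) = slide i n p"
proof (induction n arbitrary: i p)
  case (Suc n)
  show ?case
    using block_raise[of i "Suc n" _ a] Suc.IH[of "i + 1"]
    by (simp add: raise_col_def split_sum_map)
qed (simp add: raise_col_def)

lemma slide_nabla_raise: "slide_nabla i n (p \<up> a) = slide_nabla i n p"
proof (cases p)
  case (Cons y p')
  have "slide i n (map (\<lambda>x. letter (val x) (col x + a)) p') = slide i n p'"
    using slide_raise[of i n p' a] by (simp add: raise_col_def)
  then show ?thesis
    using col_pos[of y] by (simp add: slide_nabla_def raise_col_def Cons)
qed (simp add: raise_col_def)

text \<open>Colors are positive, so the shifted ones exceed \<open>maxcol p\<close>. This provides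
  the disjointness on which all the shuffle identities depend.\<close>

lemma disjoint_raise_maxcol: "set p \<inter> set (q \<up> maxcol p) = {}"
proof -
  have "col x \<le> maxcol p" if "x \<in> set p" for x
    unfolding maxcol_def using that by (intro Max_ge) auto
  moreover have "col x > maxcol p" if "x \<in> set (q \<up> maxcol p)" for x
  proof -
    from that obtain y where "x = letter (val y) (col y + maxcol p)"
      by (auto simp: raise_col_def)
    then show ?thesis using col_pos[of y] by simp
  qed
  ultimately show ?thesis by fastforce
qed

section \<open>Characters and derivations of the colored shuffle product\<close>

lemma lin_ext_cshuffle: "lin_ext f (cshuffle p q) = shuffle_sum f p (q \<up> maxcol p)"
  by (simp add: cshuffle_def shuffle_def lin_ext_sum_list shuffle_sum_def o_def)

lemma Qmult_basis: "basis p \<star> basis q = cshuffle p q"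
  by (simp add: Qmult_def)

lemma Qmult_add_left: "(a + b) \<star> c = a \<star> c + b \<star> c"
  and Qmult_scale_left: "scale z a \<star> c = scale z (a \<star> c)"
  by (simp_all add: Qmult_def lin_ext_add lin_ext_scale)

lemma Qmult_basis_add_right: "basis p \<star> (a + b) = basis p \<star> a + basis p \<star> b"
  and Qmult_basis_scale_right: "basis p \<star> scale z a = scale z (basis p \<star> a)"
  by (simp_all add: Qmult_def lin_ext_add lin_ext_scale)

lemma lin_ext_slide_mult:
  "lin_ext (slide i n) (a \<star> b) = lin_ext (slide i n) a * lin_ext (slide i n) b"
proof (induction a rule: basis_induct)
  case (basis p)
  show ?case
  proof (induction b rule: basis_induct)
    case (basis q)
    show ?case
      by (simp add: Qmult_basis lin_ext_cshuffle shuffle_sum_slide disjoint_raise_maxcol slide_raise)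
  qed (simp_all add: Qmult_basis_add_right Qmult_basis_scale_right lin_ext_add lin_ext_scale
      distrib_left scale_times_right)
qed (simp_all add: Qmult_add_left Qmult_scale_left lin_ext_add lin_ext_scale
      distrib_right scale_times_left)

lemma lin_ext_slide_nabla_mult:
  "lin_ext (slide_nabla i n) (a \<star> b) =
    lin_ext (slide_nabla i n) a * lin_ext (slide i n) b + lin_ext (slide i n) a * lin_ext (slide_nabla i n) b"
proof (induction a rule: basis_induct)
  case (basis p)
  show ?case
  proof (induction b rule: basis_induct)
    case (basis q)
    show ?case
      by (simp add: Qmult_basis lin_ext_cshuffle shuffle_sum_slide_nabla disjoint_raise_maxcol
          slide_raise slide_nabla_raise)
  qed (simp_all add: Qmult_basis_add_right Qmult_basis_scale_right lin_ext_add lin_ext_scale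
      distrib_left scale_times_right Q.scale_right_distrib)
qed (simp_all add: Qmult_add_left Qmult_scale_left lin_ext_add lin_ext_scale
      distrib_right scale_times_left Q.scale_right_distrib)

section \<open>The total derivative of a Schubert polynomial\<close>

text \<open>If \<open>f\<close> is read as the formal sum of \<open>f w\<close> times the nilCoxeter
  basis element of \<open>w\<close>, this is left multiplication by the generator with index
  \<open>k\<close>.\<close>

definition weak_op :: "int \<Rightarrow> ((int \<Rightarrow> int) \<Rightarrow> mpoly) endo" where
  "weak_op k = Endo (\<lambda>f w. if left_descent w k then f (adj k \<circ> w) else 0)"

definition mult_op :: "mpoly \<Rightarrow> ((int \<Rightarrow> int) \<Rightarrow> mpoly) endo" where
  "mult_op x = Endo (\<lambda>f w. x * f w)"

definition deriv_op :: "((int \<Rightarrow> int) \<Rightarrow> mpoly) endo" where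
  "deriv_op = Endo (\<lambda>f w. total_deriv (f w))"

lemma app_ops:
  "app (weak_op k) f w = (if left_descent w k then f (adj k \<circ> w) else 0)"
  "app (mult_op x) f w = x * f w"
  "app deriv_op f w = total_deriv (f w)"
  by (simp_all add: weak_op_def mult_op_def deriv_op_def app_Endo plus_fun_def fun_eq_iff
      distrib_left total_deriv_add)

lemma app_zero [simp]: "app g 0 = 0"
  using app_add[of g 0 0] by simp

interpretation weak: nil_coxeter weak_op
proof
  fix k
  show "weak_op k * weak_op k = 0"
  proof (intro endo_eqI ext)
    fix f w
    show "app (weak_op k * weak_op k) f w = app 0 f w"
      using left_descent_adj_comp[of w k] by (auto simp: app_ops left_descent_def)
  qed
next
  fix j k :: int
  assume jk: "j + 2 \<le> k"
  have desc: "left_descent (adj j \<circ> w) k = left_descent w k"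
      "left_descent (adj k \<circ> w) j = left_descent w j" for w
    using jk by (auto simp: left_descent_def inv_adj_comp transpose_def)
  have comm: "adj k \<circ> (adj j \<circ> w) = adj j \<circ> (adj k \<circ> w)" for w
    using jk by (auto simp: fun_eq_iff transpose_def)
  show "weak_op j * weak_op k = weak_op k * weak_op j"
    by (intro endo_eqI ext) (simp add: app_ops desc comm)
next
  fix k
  have comm: "adj k \<circ> (adj (k + 1) \<circ> (adj k \<circ> w)) = adj (k + 1) \<circ> (adj k \<circ> (adj (k + 1) \<circ> w))"
    for w
    by (auto simp: fun_eq_iff transpose_def)
  \<comment> \<open>Either side says that \<open>inv w\<close> reverses the order of
    \<open>k\<close>, \<open>k + 1\<close> and \<open>k + 2\<close>.\<close>
  have desc: "left_descent w k \<and> left_descent (adj k \<circ> w) (k + 1) \<and>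
        left_descent (adj (k + 1) \<circ> (adj k \<circ> w)) k \<longleftrightarrow>
      left_descent w (k + 1) \<and> left_descent (adj (k + 1) \<circ> w) k \<and>
        left_descent (adj k \<circ> (adj (k + 1) \<circ> w)) (k + 1)" for w
  proof (cases "bij w")
    case True
    have "adj k k = k + 1" "adj k (k + 1) = k" "adj k (k + 1 + 1) = k + 1 + 1"
        "adj (k + 1) k = k" "adj (k + 1) (k + 1) = k + 1 + 1" "adj (k + 1) (k + 1 + 1) = k + 1"
      by (simp_all add: transpose_def)
    then show ?thesis
      using True by (simp only: left_descent_def bij_adj_comp_iff inv_adj_comp) auto
  qed (simp add: left_descent_def)
  show "weak_op k * weak_op (k + 1) * weak_op k = weak_op (k + 1) * weak_op k * weak_op (k + 1)"
  proof (intro endo_eqI ext)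
    fix f w
    show "app (weak_op k * weak_op (k + 1) * weak_op k) f w =
        app (weak_op (k + 1) * weak_op k * weak_op (k + 1)) f w"
      using desc[of w] by (auto simp only: app_ring app_ops comm split: if_splits)
  qed
qed

section \<open>Operators acting on sums over reduced words\<close>

definition reduced_sum :: "(int list \<Rightarrow> mpoly) \<Rightarrow> (int \<Rightarrow> int) \<Rightarrow> mpoly" where
  "reduced_sum h w = (\<Sum>ws\<in>reduced_words w. h ws)"

text \<open>By \<open>Cons_in_reduced_words_iff\<close>, prefixing \<open>k\<close> matches the
  reduced words of \<open>adj k \<circ> w\<close> with those of \<open>w\<close> that start with
  \<open>k\<close>, if \<open>k\<close> is a descent.\<close>

lemma app_weak_op_reduced_sum:
  "app (weak_op k) (reduced_sum h) =
     reduced_sum (\<lambda>ws. case ws of [] \<Rightarrow> 0 | y # v \<Rightarrow> if y = k then h v else 0)"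
proof
  fix w
  let ?F = "\<lambda>ws. case ws of [] \<Rightarrow> 0 | y # v \<Rightarrow> if y = k then h v else 0"
  let ?V = "{v. k # v \<in> reduced_words w}"
  have "reduced_sum ?F w = sum ?F ((#) k ` ?V)"
    unfolding reduced_sum_def
    by (intro sum.mono_neutral_right finite_reduced_words) (auto split: list.splits)
  also have "\<dots> = sum h ?V"
    by (subst sum.reindex) auto
  also have "\<dots> = app (weak_op k) (reduced_sum h) w"
    by (simp add: app_ops reduced_sum_def Cons_in_reduced_words_iff)
  finally show "app (weak_op k) (reduced_sum h) w = reduced_sum ?F w" ..
qed

lemma reduced_sum_cong:
  "(\<And>w ws. ws \<in> reduced_words w \<Longrightarrow> h ws = h' ws) \<Longrightarrow> reduced_sum h = reduced_sum h'"
  by (auto simp: reduced_sum_def fun_eq_iff intro: sum.cong)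

lemma reduced_sum_add: "reduced_sum h + reduced_sum h' = reduced_sum (\<lambda>ws. h ws + h' ws)"
  by (simp add: fun_eq_iff reduced_sum_def sum.distrib)

lemma app_mult_op_reduced_sum: "app (mult_op x) (reduced_sum h) = reduced_sum (\<lambda>ws. x * h ws)"
  by (simp add: fun_eq_iff app_ops reduced_sum_def sum_distrib_left)

definition strict_block :: "int \<Rightarrow> nat \<Rightarrow> mpoly \<Rightarrow> int list \<Rightarrow> mpoly" where
  "strict_block i n x ws =
     of_bool (sorted_wrt (>) ws \<and> (\<forall>y\<in>set ws. i \<le> y \<and> y < i + int n)) * x ^ length ws"

text \<open>Expanding the product selects a decreasing set of indices, and these are stripped from
  the front of the word. The empty case relies on \<open>strict_block\<close> with
  \<open>n = 0\<close> accepting only the empty factor.\<close>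

lemma app_A_reduced_sum:
  "app (weak.A (mult_op x) i n) (reduced_sum h) =
     reduced_sum (split_sum (\<lambda>r s. strict_block i n x r * h s))"
proof (induction n)
  case 0
  have "split_sum (\<lambda>r s. strict_block i 0 x r * h s) ws = h ws" for ws
  proof (cases ws)
    case (Cons y v)
    have "strict_block i 0 x (y # r) = 0" for r by (auto simp: strict_block_def)
    then show ?thesis by (simp add: Cons) (simp add: strict_block_def)
  qed (simp add: strict_block_def)
  then show ?case by simp
next
  case (Suc n)
  let ?t = "i + int n"
  let ?h = "split_sum (\<lambda>r s. strict_block i n x r * h s)"
  have Cons: "strict_block i (Suc n) x (y # r) =
      (if y = ?t then x * strict_block i n x r else strict_block i n x (y # r))"
    and top: "strict_block i n x (?t # r) = 0" for y r
    by (auto simp: strict_block_def)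
  have Nil: "strict_block i m x [] = 1" for m
    by (simp add: strict_block_def)
  have "?h ws + x * (case ws of [] \<Rightarrow> 0 | y # v \<Rightarrow> if y = ?t then ?h v else 0) =
      split_sum (\<lambda>r s. strict_block i (Suc n) x r * h s) ws" for ws
    by (cases ws) (auto simp: Cons top Nil mult.assoc split_sum_mult_left)
  then show ?case
    unfolding weak.A_Suc_top
    by (simp add: Suc distrib_right app_weak_op_reduced_sum app_mult_op_reduced_sum reduced_sum_add)
qed

lemma app_T_reduced_sum:
  "app (weak.T i n) (reduced_sum h) =
     reduced_sum (\<lambda>ws. case ws of [] \<Rightarrow> 0 | y # v \<Rightarrow> if i \<le> y \<and> y < i + int n then h v else 0)"
proof (induction n arbitrary: i)
  case 0
  show ?case
    unfolding reduced_sum_def fun_eq_iff by (auto intro!: sum.neutral split: list.splits)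
next
  case (Suc n)
  show ?case
    by (simp only: weak.T.simps app_ring Suc app_weak_op_reduced_sum reduced_sum_add)
      (intro reduced_sum_cong, auto split: list.splits)
qed

lemma app_E_reduced_sum:
  "app (weak.E i n) (reduced_sum h) =
     reduced_sum (\<lambda>ws. case ws of [] \<Rightarrow> 0 | y # v \<Rightarrow>
       if i \<le> y \<and> y < i + int n then scale (of_int (y - i + 1)) (h v) else 0)"
proof (induction n arbitrary: i)
  case 0
  show ?case
    unfolding reduced_sum_def fun_eq_iff by (auto intro!: sum.neutral split: list.splits)
next
  case (Suc n)
  \<comment> \<open>One unit of the weight comes from \<open>T i\<close>, the remaining
    \<open>y - i\<close> from \<open>E (i + 1)\<close>.\<close>
  have *: "scale (of_int y - of_int i + 1) (h v) = h v + scale (of_int y - of_int i) (h v)" for y v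
    by (simp add: Q.scale_left_distrib add.commute)
  show ?case
    by (simp only: weak.E.simps app_ring Suc app_T_reduced_sum reduced_sum_add)
      (intro reduced_sum_cong, auto simp: * split: list.splits)
qed

abbreviation word_of :: "int list \<Rightarrow> cword" where
  "word_of ws \<equiv> map (\<lambda>i. letter i 1) ws"

lemma block_word_of:
  "distinct_adj ws \<Longrightarrow> block i n (word_of ws) = strict_block i n (var i) ws"
proof -
  assume "distinct_adj ws"
  then have "sorted_wrt (\<ge>) (word_of ws) \<longleftrightarrow> sorted_wrt (>) ws"
  proof (induction ws)
    case (Cons x ws)
    then show ?case
      by (cases ws) (auto simp: less_eq_letter_def, fastforce+)
  qed simp
  then show ?thesis
    by (simp add: block_def strict_block_def)
qed

text \<open>The indicator of \<open>id\<close> is the unit of the nilCoxeter algebra, so its image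
  is the product \<open>S\<close> itself; its coefficients are the truncated Schubert polynomials,
  expanded into slides.\<close>

lemma app_S_reduced_sum:
  "app (weak.S (\<lambda>j. mult_op (var j)) i n) (\<lambda>w. of_bool (w = id)) =
     reduced_sum (\<lambda>ws. slide i n (word_of ws))"
proof (induction n arbitrary: i)
  case 0
  show ?case
  proof
    fix w
    have "reduced_sum (\<lambda>ws. of_bool (ws = [])) w = (\<Sum>ws\<in>{ws\<in>reduced_words w. ws = []}. 1)"
      unfolding reduced_sum_def
      by (intro sum.mono_neutral_cong_right finite_reduced_words) auto
    also have "{ws\<in>reduced_words w. ws = []} = (if w = id then {[]} else {})"
      using Nil_in_reduced_words_iff[of w] by auto
    finally show "app (weak.S (\<lambda>j. mult_op (var j)) i 0) (\<lambda>w. of_bool (w = id)) w =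
        reduced_sum (\<lambda>ws. slide i 0 (word_of ws)) w"
      by simp
  qed
next
  case (Suc n)
  have "split_sum (\<lambda>r s. strict_block i (Suc n) (var i) r * slide (i + 1) n (word_of s)) ws =
      slide i (Suc n) (word_of ws)" if "ws \<in> reduced_words w" for ws w
    unfolding slide.simps split_sum_map
    using distinct_adj_reduced_word[OF that]
    by (intro split_sum_cong) (auto simp: block_word_of distinct_adj_append_iff simp del: One_nat_def)
  then show ?case
    unfolding weak.S.simps app_ring Suc app_A_reduced_sum by (intro reduced_sum_cong)
qed

text \<open>The operator identity \<open>derivation_S\<close> is applied to the indicator of
  \<open>id\<close>, whose derivative is \<open>0\<close>. The element \<open>E\<close> that remains
  strips a first letter with the weight of \<open>slide_nabla\<close>.\<close>

lemma total_deriv_reduced_sum_slide: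
  "total_deriv (reduced_sum (\<lambda>ws. slide i n (word_of ws)) w) =
     reduced_sum (\<lambda>ws. slide_nabla i n (word_of ws)) w"
proof -
  let ?S = "weak.S (\<lambda>j. mult_op (var j)) i n" and ?\<delta> = "\<lambda>w::int \<Rightarrow> int. of_bool (w = id) :: mpoly"
  have "deriv_op * ?S = weak.E i n * ?S + ?S * deriv_op"
    by (rule weak.derivation_S)
      (auto intro!: endo_eqI ext simp: app_ops total_deriv_mult)
  from arg_cong[OF this, of "\<lambda>g. app g ?\<delta>"]
  have "app deriv_op (app ?S ?\<delta>) = app (weak.E i n) (app ?S ?\<delta>) + app ?S (app deriv_op ?\<delta>)"
    by (simp only: app_ring)
  moreover have "app deriv_op ?\<delta> = 0"
    by (auto simp: fun_eq_iff app_ops of_bool_def)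
  ultimately have "app deriv_op (app ?S ?\<delta>) w = app (weak.E i n) (app ?S ?\<delta>) w"
    by simp
  moreover have "(case ws of [] \<Rightarrow> 0 | y # v \<Rightarrow>
       if i \<le> y \<and> y < i + int n then scale (of_int (y - i + 1)) (slide i n (word_of v)) else 0) =
      slide_nabla i n (word_of ws)" for ws
    by (cases ws) (simp_all add: slide_nabla_def)
  ultimately show ?thesis
    by (simp only: app_S_reduced_sum app_E_reduced_sum app_ops)
qed

lemma lin_ext_Sch: "lin_ext f (Sch w) = reduced_sum (\<lambda>ws. f (word_of ws)) w"
  by (simp add: Sch_def lin_ext_sum reduced_sum_def)

text \<open>Both sides are derivations over the character \<open>slide\<close> and agree on the
  generators of \<open>R\<close>.\<close>

theorem slide_nabla_eq_total_deriv:
  "a \<in> R \<Longrightarrow> lin_ext (slide_nabla i n) a = total_deriv (lin_ext (slide i n) a)"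
proof (induction rule: R.induct)
  case one
  show ?case by (simp add: slide_nabla_def)
next
  case (Sch w)
  show ?case by (simp only: lin_ext_Sch total_deriv_reduced_sum_slide)
qed (simp_all add: lin_ext_add lin_ext_scale total_deriv_add total_deriv_scale
    lin_ext_slide_mult lin_ext_slide_nabla_mult total_deriv_mult)

section \<open>Slide polynomials in terms of maximal bottom rows\<close>

definition row_block :: "int \<Rightarrow> int list \<Rightarrow> mpoly" where
  "row_block i r = of_bool (\<forall>y\<in>set r. y = hd r \<and> i \<le> y) * var i ^ length r"

fun row_slide :: "int \<Rightarrow> nat \<Rightarrow> int list \<Rightarrow> mpoly" where
  "row_slide i 0 m = of_bool (m = [])"
| "row_slide i (Suc n) m = split_sum (\<lambda>r s. row_block i r * row_slide (i + 1) n s) m"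

lemma split_sum_eq_sum: "split_sum h p = (\<Sum>j\<le>length p. h (take j p) (drop j p))"
proof (induction p arbitrary: h)
  case (Cons x p)
  show ?case
    by (simp add: Cons sum.atMost_Suc_shift del: sum.atMost_Suc)
qed simp

text \<open>The row is computed from the right, so a new first letter leaves the later entries
  unchanged.\<close>

lemma max_bottom_row_Cons: "\<exists>c. max_bottom_row (t # ts) = c # max_bottom_row ts"
  by (cases ts) (simp_all add: Let_def)

lemma length_max_bottom_row [simp]: "length (max_bottom_row p) = length p"
proof (induction p)
  case (Cons t ts)
  then show ?case using max_bottom_row_Cons[of t ts] by auto
qed simp

lemma drop_max_bottom_row: "drop j (max_bottom_row p) = max_bottom_row (drop j p)"
proof (induction p arbitrary: j)
  case (Cons t ts)
  then show ?case using max_bottom_row_Cons[of t ts] by (cases j) auto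
qed simp

lemma max_bottom_row_eq_Nil_iff [simp]: "max_bottom_row p = [] \<longleftrightarrow> p = []"
  by (metis length_0_conv length_max_bottom_row)

lemma max_bottom_row_Cons2:
  "max_bottom_row (t # u # ts) = (if u \<le> t then hd (max_bottom_row (u # ts))
     else min (val t) (hd (max_bottom_row (u # ts)) - 1)) # max_bottom_row (u # ts)"
  by (simp add: Let_def)

lemma hd_max_bottom_row_le: "hd (max_bottom_row (t # ts)) \<le> val t"
proof (induction ts arbitrary: t)
  case (Cons u ts)
  have "hd (max_bottom_row (u # ts)) \<le> val u" by (rule Cons.IH)
  moreover have "val u \<le> val t" if "u \<le> t" using that by (auto simp: less_eq_letter_def)
  ultimately show ?case
    unfolding max_bottom_row_Cons2 by auto
qed simp

lemma sorted_max_bottom_row: "sorted (max_bottom_row p)"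
proof (induction p rule: max_bottom_row.induct)
  case (3 t u ts)
  obtain c where c: "max_bottom_row (u # ts) = c # max_bottom_row ts"
    using max_bottom_row_Cons by blast
  show ?case
    using 3 unfolding max_bottom_row_Cons2 c by auto
qed simp_all

text \<open>Neighboring row entries agree exactly where there is no ascent. Since \<open>q\<close>
  is empty or its row starts above \<open>i\<close>, an ascent into \<open>q\<close> lowers the last
  entry over \<open>p\<close> below \<open>i\<close> only if the letter itself has value below
  \<open>i\<close>.\<close>

lemma decreasing_prefix_iff_constant_row:
  assumes "q = [] \<or> i < hd (max_bottom_row q)"
  shows "sorted_wrt (\<ge>) p \<and> (\<forall>y\<in>set p. i \<le> val y) \<longleftrightarrow>
    (\<forall>y\<in>set (take (length p) (max_bottom_row (p @ q))).
       y = hd (take (length p) (max_bottom_row (p @ q))) \<and> i \<le> y)"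
proof (induction p)
  case (Cons t p)
  show ?case
  proof (cases p)
    case Nil
    show ?thesis
    proof (cases q)
      case (Cons u us)
      then have "i < hd (max_bottom_row (u # us))" using assms by simp
      moreover have "hd (max_bottom_row (u # us)) \<le> val u" by (rule hd_max_bottom_row_le)
      ultimately show ?thesis
        using Nil Cons by (auto simp: max_bottom_row_Cons2 less_eq_letter_def simp del: max_bottom_row.simps)
    qed (simp add: Nil)
  next
    case (Cons u us)
    obtain c where c: "max_bottom_row (u # us @ q) = c # max_bottom_row (us @ q)"
      using max_bottom_row_Cons by blast
    have le: "c \<le> val u" using hd_max_bottom_row_le[of u "us @ q"] c by simp
    have IH: "sorted_wrt (\<ge>) (u # us) \<and> (\<forall>y\<in>set (u # us). i \<le> val y) \<longleftrightarrow>
        (\<forall>y\<in>set (take (length us) (max_bottom_row (us @ q))). y = c) \<and> i \<le> c"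
      using Cons.IH by (auto simp: Cons c)
    have tr: "sorted_wrt (\<ge>) (t # u # us) \<and> (\<forall>y\<in>set (t # u # us). i \<le> val y) \<longleftrightarrow>
        u \<le> t \<and> sorted_wrt (\<ge>) (u # us) \<and> (\<forall>y\<in>set (u # us). i \<le> val y)"
      by (auto simp: less_eq_letter_def)
    show ?thesis
      unfolding Cons tr IH
      by (auto simp: max_bottom_row_Cons2 c simp del: max_bottom_row.simps)
  qed
qed simp

lemma row_slide_eq_0: "m \<noteq> [] \<Longrightarrow> hd m < i \<Longrightarrow> row_slide i n m = 0"
proof (induction n arbitrary: i)
  case (Suc n)
  obtain c m' where m: "m = c # m'" using Suc.prems(1) by (cases m) auto
  have "row_block i (c # r) = 0" for r
    using Suc.prems by (auto simp: row_block_def m)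
  moreover have "row_slide (i + 1) n (c # m') = 0"
    using Suc by (simp add: m)
  ultimately show ?case by (simp add: m)
qed simp

text \<open>The two sums over cut points agree term by term, which shows that \<open>slide\<close>
  depends only on the maximal bottom row.\<close>

lemma slide_eq_row_slide:
  "\<forall>y\<in>set p. val y < i + int n \<Longrightarrow> slide i n p = row_slide i n (max_bottom_row p)"
proof (induction n arbitrary: i p)
  case (Suc n)
  have "block i (Suc n) (take j p) * slide (i + 1) n (drop j p) =
      row_block i (take j (max_bottom_row p)) * row_slide (i + 1) n (drop j (max_bottom_row p))"
    if j: "j \<le> length p" for j
  proof -
    let ?q = "drop j p"
    have slide: "slide (i + 1) n ?q = row_slide (i + 1) n (max_bottom_row ?q)"
      using Suc.prems by (intro Suc.IH) (auto dest!: in_set_dropD simp: add_ac)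
    show ?thesis
    \<comment> \<open>If the row of the remainder starts at \<open>i\<close> or below, the variables
      from \<open>i + 1\<close> on annihilate it on both sides; otherwise the criterion for constant
      prefixes applies.\<close>
    proof (cases "?q = [] \<or> i < hd (max_bottom_row ?q)")
      case True
      have upper: "\<forall>y\<in>set (take j p). val y < i + int (Suc n)"
        using Suc.prems by (auto dest: in_set_takeD)
      have "sorted_wrt (\<ge>) (take j p) \<and> (\<forall>y\<in>set (take j p). i \<le> val y \<and> val y < i + int (Suc n)) \<longleftrightarrow>
          (\<forall>y\<in>set (take j (max_bottom_row p)). y = hd (take j (max_bottom_row p)) \<and> i \<le> y)"
        using decreasing_prefix_iff_constant_row[OF True, of "take j p"] j upper
        by (auto simp: min_absorb2)
      then have "block i (Suc n) (take j p) = row_block i (take j (max_bottom_row p))"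
        using j by (simp add: block_def row_block_def min_absorb2 flip: mult.assoc of_bool_conj)
      then show ?thesis by (simp add: slide drop_max_bottom_row)
    next
      case False
      then have "row_slide (i + 1) n (max_bottom_row ?q) = 0"
        by (intro row_slide_eq_0) auto
      then show ?thesis by (simp add: slide drop_max_bottom_row)
    qed
  qed
  then show ?case by (simp add: split_sum_eq_sum)
qed simp

section \<open>Leading monomials and linear independence\<close>

lemma lookup_basis_times:
  "Poly_Mapping.lookup (basis X * a) Y = (if X \<subseteq># Y then Poly_Mapping.lookup a (Y - X) else 0)"
  for a :: mpoly
proof (induction a rule: basis_induct)
  case (basis Z)
  have "X + Z = Y \<longleftrightarrow> X \<subseteq># Y \<and> Z = Y - X" by auto
  then show ?case
    by (auto simp: basis_times_basis lookup_single when_def)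
qed (simp_all add: distrib_left scale_times_right lookup_add)

lemma var_power: "var i ^ k = basis (replicate_mset k i)"
  by (induction k) (simp_all add: basis_times_basis flip: zero_multiset_def)

lemma lookup_row_block_times:
  "Poly_Mapping.lookup (row_block i r * a) X =
     of_bool ((\<forall>y\<in>set r. y = hd r \<and> i \<le> y) \<and> replicate_mset (length r) i \<subseteq># X) *
       Poly_Mapping.lookup a (X - replicate_mset (length r) i)"
  by (simp add: row_block_def var_power lookup_basis_times of_bool_def)

lemma lookup_row_slide_Suc:
  "Poly_Mapping.lookup (row_slide i (Suc n) m) X =
     (\<Sum>j\<le>length m. Poly_Mapping.lookup (row_block i (take j m) * row_slide (i + 1) n (drop j m)) X)"
  by (simp add: split_sum_eq_sum lookup_sum)

lemma lookup_row_slide_nonneg: "Poly_Mapping.lookup (row_slide i n m) X \<ge> 0"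
proof (induction n arbitrary: i m X)
  case 0
  show ?case by (simp add: lookup_one when_def)
next
  case (Suc n)
  show ?case
    unfolding lookup_row_slide_Suc
    by (auto simp: lookup_row_block_times Suc intro!: sum_nonneg)
qed

text \<open>Cutting after the entries equal to \<open>i\<close> produces the monomial of
  \<open>m\<close>, and nonnegative coefficients exclude cancellation.\<close>

lemma lookup_row_slide_self:
  assumes "sorted m" "set m \<subseteq> {i..<i + int n}"
  shows "Poly_Mapping.lookup (row_slide i n m) (mset m) > 0"
  using assms
proof (induction n arbitrary: i m)
  case 0
  then show ?case by (simp add: lookup_one when_def)
next
  case (Suc n)
  define r s where "r = takeWhile (\<lambda>y. y = i) m" and "s = dropWhile (\<lambda>y. y = i) m"
  have m: "m = r @ s" by (simp add: r_def s_def)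
  have r: "y = i" if "y \<in> set r" for y
    using that by (auto simp: r_def dest: set_takeWhileD)
  have mr: "mset r = replicate_mset (length r) i"
    using r by (induction r) auto
  have s: "sorted s" using Suc.prems(1) by (simp add: m sorted_append)
  have "y \<noteq> i" if "y \<in> set s" for y
  proof (cases s)
    case (Cons z zs)
    then have "z \<noteq> i" unfolding s_def by (simp add: dropWhile_eq_Cons_conv)
    moreover have "z \<ge> i" using Suc.prems(2) by (auto simp: m Cons)
    moreover have "z \<le> y" using that s by (auto simp: Cons)
    ultimately show ?thesis by simp
  qed (use that in simp)
  then have "set s \<subseteq> {i + 1..<i + 1 + int n}"
    using Suc.prems(2) by (fastforce simp: m)
  then have IH: "Poly_Mapping.lookup (row_slide (i + 1) n s) (mset s) > 0"
    using Suc.IH s by blast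
  let ?h = "\<lambda>r s. Poly_Mapping.lookup (row_block i r * row_slide (i + 1) n s) (mset m)"
  have "?h r s = Poly_Mapping.lookup (row_slide (i + 1) n s) (mset s)"
  proof -
    have "\<forall>y\<in>set r. y = hd r \<and> i \<le> y"
      using r by (cases r) auto
    then show ?thesis by (simp add: lookup_row_block_times m mr)
  qed
  then have "?h (take (length r) m) (drop (length r) m) > 0"
    using IH by (simp add: m)
  moreover have "?h a b \<ge> 0" for a b
    by (simp add: lookup_row_block_times lookup_row_slide_nonneg)
  ultimately have "(\<Sum>j\<le>length m. ?h (take j m) (drop j m)) > 0"
    by (intro sum_pos2[of _ "length r"]) (simp_all add: m)
  then show ?case
    unfolding lookup_row_slide_Suc .
qed

text \<open>Every monomial arises by weakly lowering the entries of \<open>m\<close>, so its sum of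
  indices is at most that of \<open>m\<close>, with equality only if nothing is lowered.\<close>

lemma lookup_row_slide_le:
  assumes "Poly_Mapping.lookup (row_slide i n m) X \<noteq> 0"
  shows "sum_mset X \<le> sum_list m \<and> (sum_mset X = sum_list m \<longrightarrow> X = mset m)"
  using assms
proof (induction n arbitrary: i m X)
  case 0
  then show ?case by (cases "m = []") (auto simp: lookup_one when_def split: if_splits)
next
  case (Suc n)
  obtain j where "Poly_Mapping.lookup (row_block i (take j m) * row_slide (i + 1) n (drop j m)) X \<noteq> 0"
    using Suc.prems unfolding lookup_row_slide_Suc
    by (auto elim: sum.not_neutral_contains_not_neutral)
  moreover define r s where "r = take j m" and "s = drop j m"
  moreover define k Y where "k = length r" and "Y = X - replicate_mset k i"
  ultimately have r: "\<forall>y\<in>set r. y = hd r \<and> i \<le> y" and sub: "replicate_mset k i \<subseteq># X"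
    and Y: "Poly_Mapping.lookup (row_slide (i + 1) n s) Y \<noteq> 0"
    by (auto simp: lookup_row_block_times)
  have m: "m = r @ s" by (simp add: r_def s_def)
  have X: "X = replicate_mset k i + Y" using sub by (simp add: Y_def)
  have IH: "sum_mset Y \<le> sum_list s" "sum_mset Y = sum_list s \<Longrightarrow> Y = mset s"
    using Suc.IH[OF Y] by auto
  obtain c where c: "r = replicate k c" and ic: "k = 0 \<or> i \<le> c"
  proof (cases r)
    case (Cons a r')
    have "r = replicate k (hd r)"
      unfolding k_def using r by (intro replicate_eqI) auto
    moreover have "i \<le> hd r" using r Cons by simp
    ultimately show ?thesis using that by blast
  qed (use that k_def in simp)
  have le: "int k * i \<le> int k * c"
    using ic by (auto intro: mult_left_mono)
  have sums: "sum_mset X = int k * i + sum_mset Y" "sum_list m = int k * c + sum_list s"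
    by (simp_all add: X m c sum_list_replicate sum_mset_replicate_mset)
  show ?case
  proof (intro conjI impI)
    show "sum_mset X \<le> sum_list m" using sums le IH(1) by simp
    assume "sum_mset X = sum_list m"
    then have "int k * i = int k * c" "sum_mset Y = sum_list s"
      using sums le IH(1) by linarith+
    then show "X = mset m"
      using IH(2) by (auto simp: X m c)
  qed
qed

text \<open>Triangularity: for \<open>m\<close> of largest entry sum in the support, no other row
  contributes to the coefficient at \<open>mset m\<close>, as a sorted row is determined by its
  multiset.\<close>

lemma row_slide_independent:
  assumes keys: "\<And>m. m \<in> Poly_Mapping.keys c \<Longrightarrow> sorted m \<and> set m \<subseteq> {i..<i + int n}"
    and zero: "lin_ext (row_slide i n) c = 0"
  shows "c = 0"
proof (rule ccontr)
  assume "c \<noteq> 0"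
  let ?K = "Poly_Mapping.keys c"
  have "Max (sum_list ` ?K) \<in> sum_list ` ?K"
    using \<open>c \<noteq> 0\<close> by (intro Max_in) auto
  then obtain m where m: "m \<in> ?K" and "Max (sum_list ` ?K) = sum_list m" by auto
  then have max: "sum_list m' \<le> sum_list m" if "m' \<in> ?K" for m'
    using that by (metis Max_ge finite_imageI finite_keys imageI)
  have other: "Poly_Mapping.lookup (row_slide i n m') (mset m) = 0" if "m' \<in> ?K" "m' \<noteq> m" for m'
  proof (rule ccontr)
    assume "Poly_Mapping.lookup (row_slide i n m') (mset m) \<noteq> 0"
    from lookup_row_slide_le[OF this] max[OF that(1)] have "mset m = mset m'"
      by (simp add: sum_mset_sum_list)
    with keys[OF m] keys[OF that(1)] that(2) show False
      by (metis properties_for_sort)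
  qed
  have "0 = Poly_Mapping.lookup (lin_ext (row_slide i n) c) (mset m)"
    by (simp add: zero)
  also have "\<dots> = (\<Sum>m'\<in>?K. Poly_Mapping.lookup c m' * Poly_Mapping.lookup (row_slide i n m') (mset m))"
    by (simp add: lin_ext_def lookup_sum)
  also have "\<dots> = (\<Sum>m'\<in>{m}. Poly_Mapping.lookup c m' * Poly_Mapping.lookup (row_slide i n m') (mset m))"
    using m other by (intro sum.mono_neutral_right) auto
  also have "\<dots> \<noteq> 0"
    using m lookup_row_slide_self[of m i n] keys[OF m] by (auto simp: in_keys_iff)
  finally show False by simp
qed

section \<open>The operators respect the equivalence\<close>

lemma lin_ext_cong:
  "(\<And>p. p \<in> Poly_Mapping.keys a \<Longrightarrow> f p = g p) \<Longrightarrow> lin_ext f a = lin_ext g a"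
  by (simp add: lin_ext_def)

lemma lin_ext_lin_ext: "lin_ext f (lin_ext g a) = lin_ext (\<lambda>p. lin_ext f (g p)) a"
  by (induction a rule: basis_induct) (simp_all add: lin_ext_add lin_ext_scale)

lemma lin_ext_plus: "lin_ext f a + lin_ext g a = lin_ext (\<lambda>p. f p + g p) a"
  by (simp add: lin_ext_def Q.scale_right_distrib sum.distrib)

lemma scale_lin_ext: "scale c (lin_ext f a) = lin_ext (\<lambda>p. scale c (f p)) a"
  by (simp add: lin_ext_def Q.scale_sum_right mult.commute)

lemma keys_lin_ext_subset:
  "Poly_Mapping.keys (lin_ext f a) \<subseteq> (\<Union>p\<in>Poly_Mapping.keys a. Poly_Mapping.keys (f p))"
proof
  fix x assume "x \<in> Poly_Mapping.keys (lin_ext f a)"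
  then have "(\<Sum>p\<in>Poly_Mapping.keys a. Poly_Mapping.lookup a p * Poly_Mapping.lookup (f p) x) \<noteq> 0"
    by (simp add: in_keys_iff lin_ext_def lookup_sum)
  then obtain p where "p \<in> Poly_Mapping.keys a" "Poly_Mapping.lookup (f p) x \<noteq> 0"
    by (metis (no_types, lifting) mult_zero_right sum.neutral)
  then show "x \<in> (\<Union>p\<in>Poly_Mapping.keys a. Poly_Mapping.keys (f p))"
    by (auto simp: in_keys_iff)
qed

abbreviation rows :: "Q \<Rightarrow> (int list \<Rightarrow>\<^sub>0 rat)" where
  "rows \<equiv> lin_ext (\<lambda>p. basis (max_bottom_row p))"

lemma xi_Qequiv:
  assumes "a \<doteq> b"
  shows "\<xi> a \<doteq> \<xi> b"
proof -
  have "rows (\<xi> c) = lin_ext (\<lambda>r. case r of [] \<Rightarrow> 0 | x # r' \<Rightarrow> basis r') (rows c)" for c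
    unfolding xi_def lin_ext_lin_ext
  proof (rule lin_ext_cong)
    fix p
    show "rows (case p of [] \<Rightarrow> 0 | x # p' \<Rightarrow> basis p') =
        lin_ext (\<lambda>r. case r of [] \<Rightarrow> 0 | x # r' \<Rightarrow> basis r') (basis (max_bottom_row p))"
    proof (cases p)
      case (Cons x p')
      then show ?thesis using max_bottom_row_Cons[of x p'] by auto
    qed simp
  qed
  then show ?thesis using assms by (simp add: Qequiv_iff)
qed

lemma nabla_Qequiv:
  assumes R: "a \<in> R" "b \<in> R" and ab: "a \<doteq> b"
  shows "\<nabla> a \<doteq> \<nabla> b"
proof -
  define W where "W = Poly_Mapping.keys a \<union> Poly_Mapping.keys b"
  \<comment> \<open>Row entries can lie below all letter values, so both are collected to fix the
    range of variables.\<close>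
  define Z where "Z = (\<Union>p\<in>W. val ` set p \<union> set (max_bottom_row p))"
  have "finite Z" by (simp add: Z_def W_def)
  define N where "N = nat (Max (insert 0 (abs ` Z)))"
  have N: "\<bar>z\<bar> \<le> int N" if "z \<in> Z" for z
  proof -
    have "\<bar>z\<bar> \<le> Max (insert 0 (abs ` Z))"
      using that \<open>finite Z\<close> by (intro Max_ge) auto
    moreover have "0 \<le> Max (insert 0 (abs ` Z))"
      using \<open>finite Z\<close> by (intro Max_ge) auto
    ultimately show ?thesis by (simp add: N_def)
  qed
  \<comment> \<open>The range \<open>{i..<i + int n}\<close> is \<open>{-N..N}\<close>, hence an odd
    number of variables.\<close>
  define i n where "i = - int N" and "n = Suc (2 * N)"
  have bounds: "i \<le> z \<and> z < i + int n" if "z \<in> Z" for z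
    using N[OF that] by (simp add: i_def n_def abs_le_iff)
  have row: "slide i n p = row_slide i n (max_bottom_row p)"
    and row_tl: "slide i n (tl p) = row_slide i n (max_bottom_row (tl p))" if "p \<in> W" for p
  proof -
    have "val y < i + int n" if "y \<in> set p" for y
      using bounds[of "val y"] \<open>p \<in> W\<close> that by (force simp: Z_def)
    moreover have "set (tl p) \<subseteq> set p" by (cases p) auto
    ultimately show "slide i n p = row_slide i n (max_bottom_row p)"
      "slide i n (tl p) = row_slide i n (max_bottom_row (tl p))"
      by (auto intro!: slide_eq_row_slide)
  qed
  \<comment> \<open>Tails are included because \<open>\<xi>\<close> and \<open>\<nabla>\<close>
    produce them.\<close>
  have slide: "lin_ext (slide i n) c = lin_ext (row_slide i n) (rows c)"
    if "Poly_Mapping.keys c \<subseteq> W \<union> tl ` W" for c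
    unfolding lin_ext_lin_ext using that row row_tl by (intro lin_ext_cong) auto
  have keys_xi: "Poly_Mapping.keys (\<xi> c) \<subseteq> W \<union> tl ` W"
    and keys_nabla: "Poly_Mapping.keys (\<nabla> c) \<subseteq> tl ` W"
    if "Poly_Mapping.keys c \<subseteq> W" for c
  proof -
    show "Poly_Mapping.keys (\<xi> c) \<subseteq> W \<union> tl ` W"
      unfolding xi_def using that
      by (intro subset_trans[OF keys_lin_ext_subset]) (force split: list.splits)
    show "Poly_Mapping.keys (\<nabla> c) \<subseteq> tl ` W"
      unfolding nabla_def
    proof (rule subset_trans[OF keys_lin_ext_subset])
      have "Poly_Mapping.keys (case p of [] \<Rightarrow> 0 | x # p' \<Rightarrow> scale (rat_of_int (val x)) (basis p')) \<subseteq> {tl p}"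
        for p
        by (cases p) (auto simp: in_keys_iff lookup_single when_def split: if_splits)
      with that show "(\<Union>p\<in>Poly_Mapping.keys c. Poly_Mapping.keys
          (case p of [] \<Rightarrow> 0 | x # p' \<Rightarrow> scale (rat_of_int (val x)) (basis p'))) \<subseteq> tl ` W"
        by blast
    qed
  qed
  have W: "Poly_Mapping.keys a \<subseteq> W" "Poly_Mapping.keys b \<subseteq> W" by (auto simp: W_def)
  have "lin_ext (slide i n) a = lin_ext (slide i n) b"
    using ab W by (simp add: slide Qequiv_iff le_supI1)
  \<comment> \<open>Membership in \<open>R\<close> enters here: equal slide polynomials have equal
    total derivatives.\<close>
  then have D: "lin_ext (slide_nabla i n) a = lin_ext (slide_nabla i n) b"
    using R by (simp add: slide_nabla_eq_total_deriv)
  have nabla: "lin_ext (slide_nabla i n) c =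
      lin_ext (slide i n) (\<nabla> c) + scale (of_int (1 - i)) (lin_ext (slide i n) (\<xi> c))"
    if "Poly_Mapping.keys c \<subseteq> W" for c
  proof -
    let ?f = "\<lambda>p. case p of [] \<Rightarrow> 0 | x # p' \<Rightarrow> scale (rat_of_int (val x)) (basis p')"
    let ?g = "\<lambda>p. case p of [] \<Rightarrow> 0 | x # p' \<Rightarrow> basis p'"
    have "lin_ext (slide_nabla i n) c =
        lin_ext (\<lambda>p. lin_ext (slide i n) (?f p) + scale (of_int (1 - i)) (lin_ext (slide i n) (?g p))) c"
    proof (rule lin_ext_cong)
      fix p assume "p \<in> Poly_Mapping.keys c"
      then have p: "p \<in> W" using that by auto
      show "slide_nabla i n p =
        lin_ext (slide i n) (case p of [] \<Rightarrow> 0 | x # p' \<Rightarrow> scale (rat_of_int (val x)) (basis p')) +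
        scale (rat_of_int (1 - i)) (lin_ext (slide i n) (case p of [] \<Rightarrow> 0 | x # p' \<Rightarrow> basis p'))"
      proof (cases p)
        case (Cons y p')
        then have "val y \<in> Z" using p by (force simp: Z_def)
        then show ?thesis
          using bounds[of "val y"]
          by (simp add: Cons slide_nabla_def lin_ext_scale flip: Q.scale_left_distrib)
      qed (simp add: slide_nabla_def)
    qed
    also have "\<dots> = lin_ext (\<lambda>p. lin_ext (slide i n) (?f p)) c +
        scale (of_int (1 - i)) (lin_ext (\<lambda>p. lin_ext (slide i n) (?g p)) c)"
      by (simp only: lin_ext_plus[symmetric] scale_lin_ext[symmetric])
    finally show ?thesis
      by (simp only: nabla_def xi_def lin_ext_lin_ext)
  qed
  \<comment> \<open>The multiple of \<open>\<xi>\<close> agrees for \<open>a\<close> and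
    \<open>b\<close> by the first half of the theorem, so it can be subtracted to isolate
    \<open>\<nabla>\<close>.\<close>
  have "lin_ext (slide i n) (\<xi> a) = lin_ext (slide i n) (\<xi> b)"
    using xi_Qequiv[OF ab] W by (simp add: slide keys_xi Qequiv_iff)
  with D have "lin_ext (slide i n) (\<nabla> a) = lin_ext (slide i n) (\<nabla> b)"
    using W by (simp add: nabla)
  moreover have "Poly_Mapping.keys (\<nabla> a) \<subseteq> W \<union> tl ` W" "Poly_Mapping.keys (\<nabla> b) \<subseteq> W \<union> tl ` W"
    using keys_nabla W by blast+
  ultimately have "lin_ext (row_slide i n) (rows (\<nabla> a) - rows (\<nabla> b)) = 0"
    by (simp add: lin_ext_diff slide)
  moreover have "sorted m \<and> set m \<subseteq> {i..<i + int n}"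
    if "m \<in> Poly_Mapping.keys (rows (\<nabla> a) - rows (\<nabla> b))" for m
  proof -
    have "m \<in> Poly_Mapping.keys (rows (\<nabla> a)) \<union> Poly_Mapping.keys (rows (\<nabla> b))"
      by (rule subsetD[OF keys_diff that])
    then have "m \<in> max_bottom_row ` (Poly_Mapping.keys (\<nabla> a) \<union> Poly_Mapping.keys (\<nabla> b))"
      using keys_lin_ext_subset[of "\<lambda>p. basis (max_bottom_row p)" "\<nabla> a"]
        keys_lin_ext_subset[of "\<lambda>p. basis (max_bottom_row p)" "\<nabla> b"] by auto
    then obtain p where p: "p \<in> W" and m: "m = max_bottom_row (tl p)"
      using keys_nabla[OF W(1)] keys_nabla[OF W(2)] by blast
    have "set m \<subseteq> set (max_bottom_row p)"
      unfolding m using drop_max_bottom_row[of 1 p] set_drop_subset[of 1 "max_bottom_row p"]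
      by (simp add: drop_Suc)
    then have "set m \<subseteq> Z" using p by (auto simp: Z_def)
    then have "set m \<subseteq> {i..<i + int n}" using bounds by fastforce
    then show ?thesis using sorted_max_bottom_row m by simp
  qed
  ultimately have "rows (\<nabla> a) - rows (\<nabla> b) = 0"
    by (intro row_slide_independent)
  then show ?thesis by (simp add: Qequiv_iff)
qed

theorem theorem4p23:
  fixes a b :: Q
  shows "(a \<doteq> b \<longrightarrow> \<xi> a \<doteq> \<xi> b) \<and>
         (a \<in> R \<and> b \<in> R \<longrightarrow> a \<doteq> b \<longrightarrow> \<nabla> a \<doteq> \<nabla> b)"
  using xi_Qequiv nabla_Qequiv by blast

end
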